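(* Let $\Delta$ be a locally finite thick semi-regular right-angled building with base chamber $c_0$, and let $U$ be its universal group with respect to transitive permutation groups $(G^s)_{s\in S}$ (defined using directed legal colorings with respect to $c_0$). For each $n\ge 0$, $$U_{c_0}|_{\mathsf B(c_0,n+1)}\cong\Bigl(\prod_{z\in Z_n}G_z\Bigr)\rtimes U_{c_0}|_{\mathsf B(c_0,n)},$$ where the conjugation action of $U_{c_0}|_{\mathsf B(c_0,n)}$ on $\prod_{z\in Z_n}G_z$ is given by permuting the entries of the direct product according to the action of $U_{c_0}|_{\mathsf B(c_0,n)}$ on $C_n\subseteq \mathsf B(c_0,n)$ (i.e. $g$ sends the index $(c,s)\in Z_n$ to $(g.c,s)$). Moreover, $$U_{c_0}\cong\varprojlim_n U_{c_0}|_{\mathsf B(c_0,n)}.$$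
   Context: A Coxeter system $(W,S)$ is right-angled if for all distinct $s,t\in S$ the order of $st$ is $2$ or $\infty$; $l$ denotes word length on $W$. $(q_s)_{s\in S}$ is a family of natural numbers with $q_s\ge 3$, $Y_s=\{1,\dots,q_s\}$, and $\Delta$ is the unique (locally finite) building of type $(W,S)$ in which every $s$-panel has exactly $q_s$ chambers. $\mathrm{Ch}(\Delta)$ is its set of chambers and $\delta$ its $W$-valued Weyl distance. Distinct chambers $c,d$ are $s$-adjacent if $\delta(c,d)=s$; $s$-panels are the classes of "equal or $s$-adjacent", and $\mathcal P_{s,c}$ is the $s$-panel containing $c$. A residue of type $J\subseteq S$ is a connected component of the graph on chambers keeping only edges with labels in $J$. For a residue $\mathcal R$, $\mathrm{proj}_{\mathcal R}(c)$ is the unique chamber of $\mathcal R$ closest to $c$. $\mathrm{Aut}(\Delta)$ is the group of type-preserving automorphisms. Two $s$-panels lie in a common $s$-tree-wall if they are contained in a common residue of type $\{s\}\cup\{t\in S\setminus\{s\}: ts=st\}$. A weak legal $s$-coloring is a map $h_s\colon\mathrm{Ch}(\Delta)\to Y_s$ that is bijective on every $s$-panel and such that $h_s(c)=h_s(\mathrm{proj}_{\mathcal P_2}(c))$ for all $s$-panels $\mathcal P_1,\mathcal P_2$ in a common $s$-tree-wall and all $c\in\mathcal P_1$. It is a directed legal $s$-coloring with respect to $c_0$ if moreover $h_s(\mathrm{proj}_{\mathcal P}(c_0))=1$ for every $s$-panel $\mathcal P$. For each $s\in S$, fix a directed legal $s$-coloring $h_s$ with respect to $c_0$ and a transitive group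 $G^s\le\mathrm{Sym}(Y_s)$. The universal group is $$U=\{g\in\mathrm{Aut}(\Delta)\mid (h_s|_{\mathcal P_{s,gc}})\circ g\circ(h_s|_{\mathcal P_{s,c}})^{-1}\in G^s\text{ for all }s\in S,\ c\in\mathrm{Ch}(\Delta)\}.$$ $U_{c_0}$ is the stabilizer of $c_0$ in $U$; for a set $B$ of chambers stabilized by $U_{c_0}$, $U_{c_0}|_B$ is the permutation group induced by $U_{c_0}$ on $B$. $\mathsf B(c_0,n)=\{c\mid l(\delta(c_0,c))\le n\}$. The inverse limit is taken with respect to the restriction maps. For $w\in W$ let $L(w)=\{s\in S\mid l(ws)<l(w)\}$, and let $W_1(n)=\{w\in W\mid l(w)=n,\ |L(w)|=1\}$. Put $A(n)=\{c\mid l(\delta(c_0,c))=n\}$ and $A_1(n)=\{c\in A(n)\mid\delta(c_0,c)\in W_1(n)\}$. Then $C_n$ is the set of $c\in\mathsf B(c_0,n)$ that are $s$-adjacent to some chamber of $A_1(n+1)$ for some $s\in S$, and $$Z_n=\{(c,s)\in A(n)\times S\mid \delta(c_0,c)s\in W_1(n+1)\}.$$ For $z=(c,s)\in Z_n$, $G_z:=G^s_0$, the stabilizer of $1\in Y_s$ in $G^s$. *)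

theory Defs
  imports "HOL-Algebra.Algebra"
begin

section \<open>Right-angled Coxeter systems\<close>

definition word_value :: "('w, 'm) monoid_scheme \<Rightarrow> 'w list \<Rightarrow> 'w" where
  "word_value W ws = foldr (\<lambda>x y. x \<otimes>\<^bsub>W\<^esub> y) ws \<one>\<^bsub>W\<^esub>"

text \<open>
  The congruence on the free monoid over \<open>S\<close> generated by the relations \<open>(s t)\<^sup>m = 1\<close>, where
  \<open>m\<close> is the order of \<open>s t\<close> in \<open>W\<close>, whenever that order is finite (\<open>group.ord\<close> is \<open>0\<close> for
  elements of infinite order).  For involutions the case \<open>s = t\<close> (so \<open>m = 1\<close>) is the relation
  \<open>s s = 1\<close>; hence the quotient monoid is the group with presentation
  \<open>\<langle>S | (s t)\<^sup>m\<rangle>\<close> and no formal inverses are needed.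
\<close>

inductive coxeter_equiv :: "('w, 'm) monoid_scheme \<Rightarrow> 'w set \<Rightarrow> 'w list \<Rightarrow> 'w list \<Rightarrow> bool"
  for W S where
  refl: "us \<in> lists S \<Longrightarrow> coxeter_equiv W S us us"
| sym: "coxeter_equiv W S us vs \<Longrightarrow> coxeter_equiv W S vs us"
| trans: "coxeter_equiv W S us vs \<Longrightarrow> coxeter_equiv W S vs ws \<Longrightarrow> coxeter_equiv W S us ws"
| relation: "us \<in> lists S \<Longrightarrow> vs \<in> lists S \<Longrightarrow> s \<in> S \<Longrightarrow> t \<in> S \<Longrightarrow>
    group.ord W (s \<otimes>\<^bsub>W\<^esub> t) \<noteq> 0 \<Longrightarrow>
    coxeter_equiv W S (us @ concat (replicate (group.ord W (s \<otimes>\<^bsub>W\<^esub> t)) [s, t]) @ vs) (us @ vs)"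

locale coxeter_system = group W for W :: "('w, 'm) monoid_scheme" (structure) +
  fixes S :: "'w set"
  assumes gens_closed: "S \<subseteq> carrier W"
    and generates: "generate W S = carrier W"
    and involution: "s \<in> S \<Longrightarrow> s \<noteq> \<one> \<and> s \<otimes> s = \<one>"
    and presentation: "ws \<in> lists S \<Longrightarrow> word_value W ws = \<one> \<Longrightarrow> coxeter_equiv W S ws []"

locale right_angled_coxeter_system = coxeter_system +
  assumes right_angled: "s \<in> S \<Longrightarrow> t \<in> S \<Longrightarrow> s \<noteq> t \<Longrightarrow> ord (s \<otimes> t) = 2 \<or> ord (s \<otimes> t) = 0"

definition word_length :: "('w, 'm) monoid_scheme \<Rightarrow> 'w set \<Rightarrow> 'w \<Rightarrow> nat" where
  "word_length W S w = (LEAST n. \<exists>ws \<in> lists S. length ws = n \<and> word_value W ws = w)"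

definition right_descents :: "('w, 'm) monoid_scheme \<Rightarrow> 'w set \<Rightarrow> 'w \<Rightarrow> 'w set" where
  "right_descents W S w = {s \<in> S. word_length W S (w \<otimes>\<^bsub>W\<^esub> s) < word_length W S w}"

definition W1 :: "('w, 'm) monoid_scheme \<Rightarrow> 'w set \<Rightarrow> nat \<Rightarrow> 'w set" where
  "W1 W S n = {w \<in> carrier W. word_length W S w = n \<and> card (right_descents W S w) = 1}"


section \<open>Buildings\<close>

text \<open>Buildings of type \<open>(W, S)\<close> as \<open>W\<close>-metric spaces (Abramenko--Brown).\<close>

locale weyl_building = coxeter_system W S
  for W :: "('w, 'm) monoid_scheme" (structure) and S :: "'w set" +
  fixes Ch :: "'c set" and \<delta> :: "'c \<Rightarrow> 'c \<Rightarrow> 'w"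
  assumes nonempty: "Ch \<noteq> {}"
    and dist_closed: "c \<in> Ch \<Longrightarrow> d \<in> Ch \<Longrightarrow> \<delta> c d \<in> carrier W"
    and WD1: "c \<in> Ch \<Longrightarrow> d \<in> Ch \<Longrightarrow> \<delta> c d = \<one> \<longleftrightarrow> c = d"
    and WD2: "c \<in> Ch \<Longrightarrow> d \<in> Ch \<Longrightarrow> c' \<in> Ch \<Longrightarrow> s \<in> S \<Longrightarrow> \<delta> c' c = s \<Longrightarrow>
      \<delta> c' d \<in> {s \<otimes> \<delta> c d, \<delta> c d} \<and>
      (word_length W S (s \<otimes> \<delta> c d) = word_length W S (\<delta> c d) + 1 \<longrightarrow> \<delta> c' d = s \<otimes> \<delta> c d)"
    and WD3: "c \<in> Ch \<Longrightarrow> d \<in> Ch \<Longrightarrow> s \<in> S \<Longrightarrow> \<exists>c' \<in> Ch. \<delta> c' c = s \<and> \<delta> c' d = s \<otimes> \<delta> c d"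

definition panel :: "'c set \<Rightarrow> ('c \<Rightarrow> 'c \<Rightarrow> 'w) \<Rightarrow> 'w \<Rightarrow> 'c \<Rightarrow> 'c set" where
  "panel Ch \<delta> s c = {d \<in> Ch. d = c \<or> \<delta> c d = s}"

definition panels :: "'c set \<Rightarrow> ('c \<Rightarrow> 'c \<Rightarrow> 'w) \<Rightarrow> 'w \<Rightarrow> 'c set set" where
  "panels Ch \<delta> s = panel Ch \<delta> s ` Ch"

definition residue :: "'c set \<Rightarrow> ('c \<Rightarrow> 'c \<Rightarrow> 'w) \<Rightarrow> 'w set \<Rightarrow> 'c \<Rightarrow> 'c set" where
  "residue Ch \<delta> J c = {d. (c, d) \<in> {(x, y). x \<in> Ch \<and> y \<in> Ch \<and> \<delta> x y \<in> J}\<^sup>*}"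

definition proj ::
  "('w, 'm) monoid_scheme \<Rightarrow> 'w set \<Rightarrow> ('c \<Rightarrow> 'c \<Rightarrow> 'w) \<Rightarrow> 'c set \<Rightarrow> 'c \<Rightarrow> 'c" where
  "proj W S \<delta> R c = (THE d. is_arg_min (\<lambda>x. word_length W S (\<delta> c x)) (\<lambda>x. x \<in> R) d)"

text \<open>Finite panels of the prescribed size \<open>q s \<ge> 3\<close>: thick, semi-regular and locally finite.\<close>

locale semiregular_right_angled_building =
  right_angled_coxeter_system W S + weyl_building W S Ch \<delta>
  for W :: "('w, 'm) monoid_scheme" (structure) and S :: "'w set"
    and Ch :: "'c set" and \<delta> :: "'c \<Rightarrow> 'c \<Rightarrow> 'w" +
  fixes q :: "'w \<Rightarrow> nat"
  assumes thick: "s \<in> S \<Longrightarrow> q s \<ge> 3"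
    and panel_card: "s \<in> S \<Longrightarrow> P \<in> panels Ch \<delta> s \<Longrightarrow> card P = q s"


section \<open>Legal colorings\<close>

definition common_tree_wall ::
  "('w, 'm) monoid_scheme \<Rightarrow> 'w set \<Rightarrow> 'c set \<Rightarrow> ('c \<Rightarrow> 'c \<Rightarrow> 'w) \<Rightarrow> 'w \<Rightarrow> 'c set \<Rightarrow> 'c set \<Rightarrow> bool"
where
  "common_tree_wall W S Ch \<delta> s P1 P2 \<longleftrightarrow>
    (\<exists>c \<in> Ch. let R = residue Ch \<delta> ({s} \<union> {t \<in> S - {s}. t \<otimes>\<^bsub>W\<^esub> s = s \<otimes>\<^bsub>W\<^esub> t}) c
              in P1 \<subseteq> R \<and> P2 \<subseteq> R)"

definition weak_legal_coloring ::
  "('w, 'm) monoid_scheme \<Rightarrow> 'w set \<Rightarrow> 'c set \<Rightarrow> ('c \<Rightarrow> 'c \<Rightarrow> 'w) \<Rightarrow> ('w \<Rightarrow> nat) \<Rightarrow> 'w \<Rightarrow> ('c \<Rightarrow> nat) \<Rightarrow> bool"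
where
  "weak_legal_coloring W S Ch \<delta> q s h \<longleftrightarrow>
    (\<forall>P \<in> panels Ch \<delta> s. bij_betw h P {1..q s}) \<and>
    (\<forall>P1 \<in> panels Ch \<delta> s. \<forall>P2 \<in> panels Ch \<delta> s. common_tree_wall W S Ch \<delta> s P1 P2 \<longrightarrow>
      (\<forall>c \<in> P1. h c = h (proj W S \<delta> P2 c)))"

definition directed_legal_coloring ::
  "('w, 'm) monoid_scheme \<Rightarrow> 'w set \<Rightarrow> 'c set \<Rightarrow> ('c \<Rightarrow> 'c \<Rightarrow> 'w) \<Rightarrow> ('w \<Rightarrow> nat) \<Rightarrow> 'c \<Rightarrow> 'w \<Rightarrow> ('c \<Rightarrow> nat) \<Rightarrow> bool"
where
  "directed_legal_coloring W S Ch \<delta> q c0 s h \<longleftrightarrow>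
    weak_legal_coloring W S Ch \<delta> q s h \<and>
    (\<forall>P \<in> panels Ch \<delta> s. h (proj W S \<delta> P c0) = 1)"


section \<open>The universal group\<close>

definition transitive_perm_group :: "nat \<Rightarrow> (nat \<Rightarrow> nat) set \<Rightarrow> bool" where
  "transitive_perm_group n G \<longleftrightarrow>
    subgroup G (sym_group n) \<and> (\<forall>i \<in> {1..n}. \<forall>j \<in> {1..n}. \<exists>g \<in> G. g i = j)"

definition building_auts :: "'c set \<Rightarrow> ('c \<Rightarrow> 'c \<Rightarrow> 'w) \<Rightarrow> ('c \<Rightarrow> 'c) set" where
  "building_auts Ch \<delta> = {g \<in> Bij Ch. \<forall>c \<in> Ch. \<forall>d \<in> Ch. \<delta> (g c) (g d) = \<delta> c d}"

text \<open>
  The permutation of \<open>Y\<^sub>s = {1..q s}\<close> induced at \<open>c\<close>, extended by the identity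
  outside \<open>Y\<^sub>s\<close> as required for elements of \<^const>\<open>sym_group\<close>.
\<close>

definition local_action ::
  "'c set \<Rightarrow> ('c \<Rightarrow> 'c \<Rightarrow> 'w) \<Rightarrow> ('w \<Rightarrow> nat) \<Rightarrow> ('w \<Rightarrow> 'c \<Rightarrow> nat) \<Rightarrow> 'w \<Rightarrow> 'c \<Rightarrow> ('c \<Rightarrow> 'c) \<Rightarrow> nat \<Rightarrow> nat"
where
  "local_action Ch \<delta> q h s c g =
    (\<lambda>i. if i \<in> {1..q s} then h s (g (inv_into (panel Ch \<delta> s c) (h s) i)) else i)"

definition universal_group ::
  "'w set \<Rightarrow> 'c set \<Rightarrow> ('c \<Rightarrow> 'c \<Rightarrow> 'w) \<Rightarrow> ('w \<Rightarrow> nat) \<Rightarrow> ('w \<Rightarrow> 'c \<Rightarrow> nat) \<Rightarrow> ('w \<Rightarrow> (nat \<Rightarrow> nat) set)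
    \<Rightarrow> ('c \<Rightarrow> 'c) set"
where
  "universal_group S Ch \<delta> q h G =
    {g \<in> building_auts Ch \<delta>. \<forall>s \<in> S. \<forall>c \<in> Ch. local_action Ch \<delta> q h s c g \<in> G s}"

definition chamber_stabilizer :: "'c set \<Rightarrow> ('c \<Rightarrow> 'c) set \<Rightarrow> 'c \<Rightarrow> ('c \<Rightarrow> 'c) monoid" where
  "chamber_stabilizer Ch U c0 = (BijGroup Ch)\<lparr>carrier := {g \<in> U. g c0 = c0}\<rparr>"

definition induced_perm_group :: "('c \<Rightarrow> 'c) monoid \<Rightarrow> 'c set \<Rightarrow> ('c \<Rightarrow> 'c) monoid" where
  "induced_perm_group H B = (BijGroup B)\<lparr>carrier := (\<lambda>g. restrict g B) ` carrier H\<rparr>"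


section \<open>Balls, spheres and the index sets\<close>

definition chamber_ball ::
  "('w, 'm) monoid_scheme \<Rightarrow> 'w set \<Rightarrow> 'c set \<Rightarrow> ('c \<Rightarrow> 'c \<Rightarrow> 'w) \<Rightarrow> 'c \<Rightarrow> nat \<Rightarrow> 'c set" where
  "chamber_ball W S Ch \<delta> c0 n = {c \<in> Ch. word_length W S (\<delta> c0 c) \<le> n}"

definition A_sphere ::
  "('w, 'm) monoid_scheme \<Rightarrow> 'w set \<Rightarrow> 'c set \<Rightarrow> ('c \<Rightarrow> 'c \<Rightarrow> 'w) \<Rightarrow> 'c \<Rightarrow> nat \<Rightarrow> 'c set" where
  "A_sphere W S Ch \<delta> c0 n = {c \<in> Ch. word_length W S (\<delta> c0 c) = n}"

definition A1_sphere ::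
  "('w, 'm) monoid_scheme \<Rightarrow> 'w set \<Rightarrow> 'c set \<Rightarrow> ('c \<Rightarrow> 'c \<Rightarrow> 'w) \<Rightarrow> 'c \<Rightarrow> nat \<Rightarrow> 'c set" where
  "A1_sphere W S Ch \<delta> c0 n = {c \<in> A_sphere W S Ch \<delta> c0 n. \<delta> c0 c \<in> W1 W S n}"

definition C_set ::
  "('w, 'm) monoid_scheme \<Rightarrow> 'w set \<Rightarrow> 'c set \<Rightarrow> ('c \<Rightarrow> 'c \<Rightarrow> 'w) \<Rightarrow> 'c \<Rightarrow> nat \<Rightarrow> 'c set" where
  "C_set W S Ch \<delta> c0 n =
    {c \<in> chamber_ball W S Ch \<delta> c0 n. \<exists>s \<in> S. \<exists>d \<in> A1_sphere W S Ch \<delta> c0 (n + 1). \<delta> c d = s}"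

definition Z_set ::
  "('w, 'm) monoid_scheme \<Rightarrow> 'w set \<Rightarrow> 'c set \<Rightarrow> ('c \<Rightarrow> 'c \<Rightarrow> 'w) \<Rightarrow> 'c \<Rightarrow> nat \<Rightarrow> ('c \<times> 'w) set" where
  "Z_set W S Ch \<delta> c0 n =
    {(c, s) \<in> A_sphere W S Ch \<delta> c0 n \<times> S. \<delta> c0 c \<otimes>\<^bsub>W\<^esub> s \<in> W1 W S (n + 1)}"

definition stab_one :: "nat \<Rightarrow> (nat \<Rightarrow> nat) set \<Rightarrow> (nat \<Rightarrow> nat) monoid" where
  "stab_one n G = (sym_group n)\<lparr>carrier := {g \<in> G. g 1 = 1}\<rparr>"

definition Z_product ::
  "('c \<times> 'w) set \<Rightarrow> ('w \<Rightarrow> nat) \<Rightarrow> ('w \<Rightarrow> (nat \<Rightarrow> nat) set) \<Rightarrow> ('c \<times> 'w \<Rightarrow> nat \<Rightarrow> nat) monoid" where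
  "Z_product Z q G = product_group Z (\<lambda>(c, s). stab_one (q s) (G s))"

text \<open>
  A permutation \<open>g\<close> of \<open>B\<close> moves the entry at index \<open>(c, s)\<close> to index \<open>(g c, s)\<close>, so the new
  entry at \<open>(c, s)\<close> is the old one at \<open>(g\<^sup>-\<^sup>1 c, s)\<close>.
\<close>

definition permute_entries ::
  "'c set \<Rightarrow> ('c \<times> 'w) set \<Rightarrow> ('c \<times> 'w \<Rightarrow> 'p) monoid \<Rightarrow> ('c \<Rightarrow> 'c) \<Rightarrow> ('c \<times> 'w \<Rightarrow> 'p) \<Rightarrow> ('c \<times> 'w \<Rightarrow> 'p)"
where
  "permute_entries B Z P g = (\<lambda>a \<in> carrier P. \<lambda>z \<in> Z. a (inv_into B g (fst z), snd z))"


section \<open>Semidirect products and inverse limits\<close>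

definition semidirect_product ::
  "('a, 'm) monoid_scheme \<Rightarrow> ('b, 'n) monoid_scheme \<Rightarrow> ('b \<Rightarrow> 'a \<Rightarrow> 'a) \<Rightarrow> ('a \<times> 'b) monoid" where
  "semidirect_product N H \<phi> =
    \<lparr>carrier = carrier N \<times> carrier H,
     monoid.mult = (\<lambda>(a, g) (b, h). (a \<otimes>\<^bsub>N\<^esub> \<phi> g b, g \<otimes>\<^bsub>H\<^esub> h)),
     one = (\<one>\<^bsub>N\<^esub>, \<one>\<^bsub>H\<^esub>)\<rparr>"

definition inverse_limit ::
  "(nat \<Rightarrow> ('a, 'm) monoid_scheme) \<Rightarrow> (nat \<Rightarrow> nat \<Rightarrow> 'a \<Rightarrow> 'a) \<Rightarrow> (nat \<Rightarrow> 'a) monoid" where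
  "inverse_limit K \<rho> = (product_group UNIV K)
    \<lparr>carrier := {x \<in> carrier (product_group UNIV K). \<forall>m n. m \<le> n \<longrightarrow> \<rho> m n (x n) = x m}\<rparr>"

end

theory Submission
  imports Defs
begin

text \<open>
  The theorem rests on coordinates for \<open>U\<^sub>c\<^sub>0\<close>.  A type-preserving automorphism \<open>g\<close> fixing \<open>c0\<close> is
  determined by its local actions: once \<open>g c\<close> is known, the local action at \<open>(c, s)\<close> tells where
  the whole \<open>s\<close>-panel of \<open>c\<close> goes.  Since \<open>g\<close> commutes with projections and \<open>h s\<close> is a weak legal
  colouring, the local action for \<open>s\<close> is the same on all panels of one \<open>s\<close>-tree-wall; since \<open>h s\<close>
  is directed, it fixes the colour \<open>1\<close>.  Conversely, every assignment to tree-walls of permutations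
  fixing \<open>1\<close> comes from such an automorphism (\<open>aut_of_wall_invariant\<close>), which is unique
  (\<open>aut_eq_on_ball\<close>).

  Each tree-wall contains exactly one panel that is closest to \<open>c0\<close>; if the closest chamber \<open>c\<close> of
  that panel is at distance \<open>n\<close>, then \<open>(c, s)\<close> lies in \<open>Z\<^sub>n\<close>, and every element of \<open>Z\<^sub>n\<close> arises
  (\<open>root_properties\<close>, \<open>Z_set_iff\<close>).  So the coordinates are indexed by the union of all \<open>Z\<^sub>n\<close>, the
  action on the ball of radius \<open>n\<close> depends only on the coordinates in \<open>Z\<^sub>m\<close> for \<open>m < n\<close>, and passing
  from radius \<open>n\<close> to radius \<open>n + 1\<close> adjoins precisely the coordinates in \<open>Z\<^sub>n\<close>, each of them free in
  its group \<open>G\<^sub>z\<close>.  Record for \<open>g\<close> and \<open>(c, s)\<close> in \<open>Z\<^sub>n\<close> the action of \<open>g\<close> on the panel that it moves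
  onto the one of \<open>(c, s)\<close>.  By the chain rule for local actions this is a homomorphism of
  \<open>U\<^sub>c\<^sub>0\<close> to the semidirect product (\<open>split_ball_hom\<close>); it is onto because the coordinates are free
  (\<open>split_ball_surj\<close>), and it has the same fibres as restriction to the ball of radius \<open>n + 1\<close>
  (\<open>split_ball_fibres\<close>).  Hence the two images are isomorphic.

  For the inverse limit, a compatible family of permutations of balls glues to a map on all chambers.
  It is an element of \<open>U\<^sub>c\<^sub>0\<close> because adjacency and local actions involve two chambers or one panel
  at a time, and hence can be tested inside a ball.

  The combinatorial input is one fact about right-angled Coxeter groups, \<open>descents_commute\<close>: two
  right descents of the same element commute.  It makes the ways of walking down towards \<open>c0\<close>
  confluent, because the squares spanned by two commuting generators close up in the building
  (\<open>nbr_commute\<close>).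
\<close>

section \<open>Inversions and descents in right-angled Coxeter groups\<close>

context coxeter_system
begin

abbreviation len :: "'w \<Rightarrow> nat" where "len \<equiv> word_length W S"
abbreviation val :: "'w list \<Rightarrow> 'w" where "val \<equiv> word_value W"

lemma gen_carrier [simp]: "s \<in> S \<Longrightarrow> s \<in> carrier W"
  using gens_closed by blast

lemma gen_square [simp]: "s \<in> S \<Longrightarrow> s \<otimes> s = \<one>"
  using involution by blast

lemma gen_square_left [simp]: "s \<in> S \<Longrightarrow> x \<in> carrier W \<Longrightarrow> s \<otimes> (s \<otimes> x) = x"
  by (simp flip: m_assoc)

lemma gen_square_right [simp]: "s \<in> S \<Longrightarrow> x \<in> carrier W \<Longrightarrow> x \<otimes> s \<otimes> s = x"
  by (simp add: m_assoc)

lemma gen_inv [simp]: "s \<in> S \<Longrightarrow> inv s = s"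
  by (simp add: inv_equality)

lemma val_Nil [simp]: "val [] = \<one>"
  by (simp add: word_value_def)

lemma val_Cons [simp]: "val (s # ws) = s \<otimes> val ws"
  by (simp add: word_value_def)

lemma val_closed [simp]: "ws \<in> lists S \<Longrightarrow> val ws \<in> carrier W"
  by (induction ws) auto

lemma val_append [simp]:
  "us \<in> lists S \<Longrightarrow> vs \<in> lists S \<Longrightarrow> val (us @ vs) = val us \<otimes> val vs"
  by (induction us) (auto simp: m_assoc)

lemma rev_in_lists [simp]: "rev ws \<in> lists A \<longleftrightarrow> ws \<in> lists A"
  by (simp add: in_lists_conv_set)

lemma val_rev: "ws \<in> lists S \<Longrightarrow> val (rev ws) = inv (val ws)"
proof (induction ws)
  case (Cons s ws)
  then have ws: "rev ws \<in> lists S" and s: "[s] \<in> lists S" by auto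
  have "val (rev (s # ws)) = inv (val ws) \<otimes> s"
    using val_append[OF ws s] Cons by simp
  then show ?case using Cons by (simp add: inv_mult_group)
qed simp

lemma word_exists:
  assumes "w \<in> carrier W"
  obtains ws where "ws \<in> lists S" "val ws = w"
proof -
  have "w \<in> generate W S" using assms generates by simp
  then have "\<exists>ws \<in> lists S. val ws = w"
  proof (induction rule: generate.induct)
    case one
    show ?case by (intro bexI[of _ "[]"]) auto
  next
    case (incl s)
    then show ?case by (intro bexI[of _ "[s]"]) auto
  next
    case (inv s)
    then show ?case by (intro bexI[of _ "[s]"]) auto
  next
    case (eng x y)
    then obtain us vs where "us \<in> lists S" "val us = x" "vs \<in> lists S" "val vs = y" by blast
    then show ?case by (intro bexI[of _ "us @ vs"]) auto
  qed
  then show thesis using that by blast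
qed

lemma reduced_word_exists:
  assumes "w \<in> carrier W"
  obtains ws where "ws \<in> lists S" "val ws = w" "length ws = len w"
proof -
  obtain vs where "vs \<in> lists S" "val vs = w" using assms word_exists by blast
  then have "\<exists>n. \<exists>ws \<in> lists S. length ws = n \<and> val ws = w" by blast
  then have "\<exists>ws \<in> lists S. length ws = len w \<and> val ws = w"
    unfolding word_length_def by (rule LeastI_ex)
  then show thesis using that by blast
qed

lemma len_le: "ws \<in> lists S \<Longrightarrow> len (val ws) \<le> length ws"
  unfolding word_length_def by (rule Least_le) blast

lemma len_one [simp]: "len \<one> = 0"
  using len_le[of "[]"] by simp

lemma len_eq_0_iff: "w \<in> carrier W \<Longrightarrow> len w = 0 \<longleftrightarrow> w = \<one>"
  by (metis len_one length_0_conv reduced_word_exists val_Nil)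

lemma len_gen [simp]:
  assumes "s \<in> S"
  shows "len s = 1"
proof -
  have "len s \<le> 1" using len_le[of "[s]"] assms by simp
  moreover have "len s \<noteq> 0" using assms len_eq_0_iff involution by auto
  ultimately show ?thesis by simp
qed

lemma len_inv:
  assumes "w \<in> carrier W"
  shows "len (inv w) = len w"
proof -
  have le: "len (inv v) \<le> len v" if v: "v \<in> carrier W" for v
  proof -
    obtain ws where ws: "ws \<in> lists S" "val ws = v" "length ws = len v"
      using v by (rule reduced_word_exists)
    then have "len (val (rev ws)) \<le> length (rev ws)" by (intro len_le) auto
    then show ?thesis by (simp only: val_rev[OF ws(1)] ws length_rev)
  qed
  have "len w \<le> len (inv w)" using le[OF inv_closed[OF assms]] assms by simp
  then show ?thesis using le[OF assms] by simp
qed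

lemma len_mult_gen_le:
  assumes "w \<in> carrier W" "s \<in> S"
  shows "len (w \<otimes> s) \<le> len w + 1"
proof -
  obtain ws where "ws \<in> lists S" "val ws = w" "length ws = len w"
    using assms reduced_word_exists by blast
  then show ?thesis using len_le[of "ws @ [s]"] assms by simp
qed

lemma len_gen_mult_le:
  assumes "w \<in> carrier W" "s \<in> S"
  shows "len (s \<otimes> w) \<le> len w + 1"
proof -
  obtain ws where "ws \<in> lists S" "val ws = w" "length ws = len w"
    using assms reduced_word_exists by blast
  then show ?thesis using len_le[of "s # ws"] assms by simp
qed

text \<open>
  A word \<open>s\<^sub>1 \<dots> s\<^sub>n\<close> has the reflections \<open>s\<^sub>n \<dots> s\<^sub>i \<dots> s\<^sub>n\<close>, and multiplying by one of
  them on the right deletes a letter.  Which reflections occur an odd number of times depends only on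
  the group element.  Appending \<open>s\<close> to a word conjugates its reflections by \<open>s\<close> and adds \<open>s\<close>; on the
  indicator function of the parity this is the operation \<open>flip s\<close>.  The parity is well defined because
  the \<open>flip\<close>s satisfy the defining relations.  They act on functions on all of \<open>W\<close>, not just on
  reflections, which avoids having to single out the conjugates of generators.
\<close>

definition flip :: "'w \<Rightarrow> ('w \<Rightarrow> bool) \<Rightarrow> 'w \<Rightarrow> bool" where
  "flip s f r \<longleftrightarrow> f (s \<otimes> r \<otimes> s) \<noteq> (r = s)"

definition inversion :: "'w \<Rightarrow> 'w \<Rightarrow> bool" where
  "inversion w r \<longleftrightarrow> (\<exists>ws \<in> lists S. val ws = w \<and> fold flip ws (\<lambda>_. False) r)"

lemma fold_flip_cong:
  assumes "ws \<in> lists S" "\<And>r. r \<in> carrier W \<Longrightarrow> f r = g r" "r \<in> carrier W"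
  shows "fold flip ws f r = fold flip ws g r"
  using assms
proof (induction ws arbitrary: f g rule: list.induct)
  case (Cons s ws)
  have "flip s f r = flip s g r" if "r \<in> carrier W" for r
  proof -
    have "s \<otimes> r \<otimes> s \<in> carrier W" using Cons.prems(1) that by simp
    then show ?thesis using Cons.prems(2) by (simp add: flip_def)
  qed
  then have "fold flip ws (flip s f) r = fold flip ws (flip s g) r"
    using Cons.prems by (intro Cons.IH) auto
  then show ?case by simp
qed auto

lemma conj_gen_eq_iff:
  assumes "s \<in> S" "r \<in> carrier W" "x \<in> carrier W"
  shows "s \<otimes> r \<otimes> s = x \<longleftrightarrow> r = s \<otimes> x \<otimes> s"
proof
  assume "s \<otimes> r \<otimes> s = x"
  then have "s \<otimes> x \<otimes> s = s \<otimes> (s \<otimes> r \<otimes> s) \<otimes> s" by simp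
  then show "r = s \<otimes> x \<otimes> s" using assms by (simp add: m_assoc)
next
  assume "r = s \<otimes> x \<otimes> s"
  then show "s \<otimes> r \<otimes> s = x" using assms by (simp add: m_assoc)
qed

lemma flip_flip:
  assumes "s \<in> S" "r \<in> carrier W"
  shows "flip s (flip s f) r = f r"
proof -
  have 1: "s \<otimes> r \<otimes> s = s \<longleftrightarrow> r = s"
    using conj_gen_eq_iff[of s r s] assms by simp
  have 2: "s \<otimes> (s \<otimes> r \<otimes> s) \<otimes> s = r"
    using assms by (simp add: m_assoc)
  show ?thesis unfolding flip_def 1 2 by blast
qed

lemma fold_flip_rev:
  assumes "ws \<in> lists S" "r \<in> carrier W"
  shows "fold flip ws (fold flip (rev ws) f) r = f r"
  using assms
proof (induction ws arbitrary: f rule: list.induct)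
  case (Cons s ws)
  have "fold flip ws (flip s (flip s (fold flip (rev ws) f))) r = fold flip ws (fold flip (rev ws) f) r"
    using Cons.prems by (intro fold_flip_cong) (auto simp: flip_flip)
  also have "\<dots> = f r"
    using Cons.prems by (intro Cons.IH) auto
  finally show ?case by simp
qed auto

end

context right_angled_coxeter_system
begin

lemma commute_if_ord:
  assumes "s \<in> S" "t \<in> S" "ord (s \<otimes> t) \<noteq> 0"
  shows "s \<otimes> t = t \<otimes> s"
proof (cases "s = t")
  case False
  then have "ord (s \<otimes> t) = 2" using right_angled[OF assms(1,2)] assms(3) by simp
  moreover have st: "s \<otimes> t \<in> carrier W" using assms by simp
  ultimately have "(s \<otimes> t) [^] (2::nat) = \<one>" using pow_ord_eq_1 by metis
  then have "(s \<otimes> t) \<otimes> (s \<otimes> t) = \<one>" using st by (simp add: numeral_2_eq_2)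
  then have "inv (s \<otimes> t) = s \<otimes> t" by (rule inv_equality[OF _ st st])
  then show ?thesis using assms by (simp add: inv_mult_group)
qed simp

lemma conj_gen_commuting:
  assumes "s \<in> S" "t \<in> S" "s \<otimes> t = t \<otimes> s"
  shows "t \<otimes> s \<otimes> t = s"
  using assms by (simp flip: assms(3))

lemma flip_commute:
  assumes "s \<in> S" "t \<in> S" "s \<otimes> t = t \<otimes> s" "r \<in> carrier W"
  shows "flip s (flip t f) r = flip t (flip s f) r"
proof -
  have 1: "t \<otimes> r \<otimes> t = s \<longleftrightarrow> r = s" "s \<otimes> r \<otimes> s = t \<longleftrightarrow> r = t"
    using assms by (simp_all add: conj_gen_eq_iff conj_gen_commuting)
  have "t \<otimes> (s \<otimes> r \<otimes> s) \<otimes> t = (t \<otimes> s) \<otimes> r \<otimes> (s \<otimes> t)"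
    using assms(1,2,4) by (simp add: m_assoc)
  also have "\<dots> = (s \<otimes> t) \<otimes> r \<otimes> (t \<otimes> s)" using assms(3) by simp
  also have "\<dots> = s \<otimes> (t \<otimes> r \<otimes> t) \<otimes> s"
    using assms(1,2,4) by (simp add: m_assoc)
  finally have 2: "t \<otimes> (s \<otimes> r \<otimes> s) \<otimes> t = s \<otimes> (t \<otimes> r \<otimes> t) \<otimes> s" .
  show ?thesis unfolding flip_def 1 2 by blast
qed

text \<open>
  By right-angledness a relator is \<open>s s\<close> or \<open>s t s t\<close> with commuting \<open>s\<close> and \<open>t\<close>; in both cases
  every letter occurs twice and the flips cancel in pairs.
\<close>

lemma fold_flip_coxeter_equiv:
  assumes "coxeter_equiv W S us vs" "r \<in> carrier W"
  shows "us \<in> lists S \<and> vs \<in> lists S \<and> fold flip us f r = fold flip vs f r"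
  using assms
proof (induction arbitrary: f r rule: coxeter_equiv.induct)
  case (relation us vs s t)
  let ?rel = "concat (replicate (ord (s \<otimes> t)) [s, t])"
  have rel: "fold flip ?rel g r = g r" if r: "r \<in> carrier W" for g r
  proof (cases "s = t")
    case True
    then have "ord (s \<otimes> t) = 1" using relation by simp
    then show ?thesis using True r relation by (simp add: flip_flip)
  next
    case False
    then have 2: "ord (s \<otimes> t) = 2"
      using right_angled[OF relation(3,4)] relation(5) by simp
    have comm: "s \<otimes> t = t \<otimes> s" using relation(3-5) by (rule commute_if_ord)
    have "fold flip ?rel g r = flip t (flip s (flip t (flip s g))) r"
      using 2 by (simp add: numeral_2_eq_2)
    also have "\<dots> = flip t (flip t (flip s (flip s g))) r"
      using flip_commute[OF relation(3,4) comm, of "t \<otimes> r \<otimes> t" "flip s g"] r relation(4)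
      by (simp add: flip_def[of t])
    also have "\<dots> = g r"
      using r relation(3,4) by (simp add: flip_flip)
    finally show ?thesis .
  qed
  have "fold flip vs (fold flip ?rel (fold flip us f)) r = fold flip vs (fold flip us f) r"
    using relation rel by (intro fold_flip_cong) auto
  moreover have "?rel \<in> lists S" using relation by auto
  ultimately show ?case using relation by simp
qed auto

text \<open>
  The presentation speaks about words of value \<open>1\<close> only; it is applied to \<open>us\<close> followed by the
  reversal of \<open>vs\<close>, and the action of the reversal is undone by \<open>fold_flip_rev\<close>.
\<close>

lemma fold_flip_val_cong:
  assumes "us \<in> lists S" "vs \<in> lists S" "val us = val vs" "r \<in> carrier W"
  shows "fold flip us f r = fold flip vs f r"
proof -
  have "val (us @ rev vs) = \<one>" using assms by (simp add: val_rev)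
  then have "coxeter_equiv W S (us @ rev vs) []" using assms presentation by simp
  then have "fold flip (rev vs) (fold flip us f) r = f r" if "r \<in> carrier W" for r
    using fold_flip_coxeter_equiv[of "us @ rev vs" "[]" r f] that by simp
  then have "fold flip vs (fold flip (rev vs) (fold flip us f)) r = fold flip vs f r"
    using assms by (intro fold_flip_cong) auto
  then show ?thesis using fold_flip_rev[of vs r "fold flip us f"] assms by simp
qed

lemma inversion_val:
  assumes "ws \<in> lists S" "r \<in> carrier W"
  shows "inversion (val ws) r \<longleftrightarrow> fold flip ws (\<lambda>_. False) r"
  unfolding inversion_def using fold_flip_val_cong assms by blast

lemma inversion_mult_gen:
  assumes "w \<in> carrier W" "s \<in> S" "r \<in> carrier W"
  shows "inversion (w \<otimes> s) r \<longleftrightarrow> inversion w (s \<otimes> r \<otimes> s) \<noteq> (r = s)"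
proof -
  obtain ws where ws: "ws \<in> lists S" "val ws = w" using assms word_exists by blast
  show ?thesis
    using inversion_val[of "ws @ [s]" r] inversion_val[of ws "s \<otimes> r \<otimes> s"] ws assms
    by (simp add: flip_def)
qed

text \<open>
  If \<open>r\<close> occurs oddly often among the reflections of a word, it occurs at all, and multiplication by
  \<open>r\<close> cancels the letter it belongs to.
\<close>

lemma strong_exchange:
  assumes "ws \<in> lists S" "r \<in> carrier W" "fold flip ws (\<lambda>_. False) r"
  shows "\<exists>vs \<in> lists S. length vs < length ws \<and> val vs = val ws \<otimes> r"
  using assms
proof (induction ws arbitrary: r rule: rev_induct)
  case (snoc s ws)
  show ?case
  proof (cases "r = s")
    case True
    then show ?thesis using snoc.prems by (intro bexI[of _ ws]) auto
  next
    case False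
    then have "fold flip ws (\<lambda>_. False) (s \<otimes> r \<otimes> s)"
      using snoc.prems by (simp add: flip_def[of s])
    then obtain vs where "vs \<in> lists S" "length vs < length ws" "val vs = val ws \<otimes> (s \<otimes> r \<otimes> s)"
      using snoc.IH[of "s \<otimes> r \<otimes> s"] snoc.prems by auto
    then show ?thesis using snoc.prems by (intro bexI[of _ "vs @ [s]"]) (auto simp: m_assoc)
  qed
qed simp

lemma len_inversion:
  assumes "w \<in> carrier W" "r \<in> carrier W" "inversion w r"
  shows "len (w \<otimes> r) < len w"
proof -
  obtain ws where ws: "ws \<in> lists S" "val ws = w" "length ws = len w"
    using assms reduced_word_exists by blast
  then have "fold flip ws (\<lambda>_. False) r" using inversion_val assms by blast
  then obtain vs where "vs \<in> lists S" "length vs < length ws" "val vs = w \<otimes> r"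
    using strong_exchange ws assms by blast
  then show ?thesis using len_le[of vs] ws by simp
qed

lemma inversion_gen_iff:
  assumes "w \<in> carrier W" "s \<in> S"
  shows "inversion (w \<otimes> s) s \<longleftrightarrow> \<not> inversion w s"
  using inversion_mult_gen[of w s s] assms by (simp add: m_assoc)

text \<open>
  An inversion shortens by the exchange property.  Conversely exactly one of \<open>w\<close> and \<open>w s\<close> has \<open>s\<close>
  as an inversion, so if it is not \<open>w\<close>, then \<open>w\<close> is a shortening of \<open>w s\<close>.
\<close>

lemma descent_iff_inversion:
  assumes "w \<in> carrier W" "s \<in> S"
  shows "s \<in> right_descents W S w \<longleftrightarrow> inversion w s"
proof -
  have "\<not> len (w \<otimes> s) < len w" if "\<not> inversion w s"
    using len_inversion[of "w \<otimes> s" s] inversion_gen_iff[of w s] assms that by simp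
  then show ?thesis using len_inversion[of w s] assms by (auto simp: right_descents_def)
qed

lemma len_descent:
  assumes "w \<in> carrier W" "s \<in> right_descents W S w"
  shows "len w = len (w \<otimes> s) + 1"
proof -
  have "s \<in> S" "len (w \<otimes> s) < len w" using assms by (auto simp: right_descents_def)
  then show ?thesis using len_mult_gen_le[of "w \<otimes> s" s] assms by simp
qed

lemma len_no_descent:
  assumes "w \<in> carrier W" "s \<in> S" "s \<notin> right_descents W S w"
  shows "len (w \<otimes> s) = len w + 1"
proof -
  have "inversion (w \<otimes> s) s"
    using assms inversion_gen_iff descent_iff_inversion by blast
  then have "s \<in> right_descents W S (w \<otimes> s)" using assms descent_iff_inversion by simp
  then show ?thesis using len_descent[of "w \<otimes> s" s] assms by simp
qed

text \<open>Conjugation by a commuting \<open>t\<close> fixes \<open>s\<close>, so passing to \<open>w t\<close> leaves its parity unchanged.\<close>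

lemma descent_mult_commuting:
  assumes "w \<in> carrier W" "s \<in> S" "t \<in> S" "s \<noteq> t" "s \<otimes> t = t \<otimes> s"
  shows "s \<in> right_descents W S (w \<otimes> t) \<longleftrightarrow> s \<in> right_descents W S w"
proof -
  have "t \<otimes> s \<otimes> t = s" using assms by (metis gen_carrier gen_square_right)
  then show ?thesis
    using assms inversion_mult_gen[of w t s] by (simp add: descent_iff_inversion)
qed

lemma descent_mult_self:
  assumes "w \<in> carrier W" "s \<in> S"
  shows "s \<in> right_descents W S (w \<otimes> s) \<longleftrightarrow> s \<notin> right_descents W S w"
  using assms inversion_gen_iff by (simp add: descent_iff_inversion)

text \<open>
  The reflections \<open>s, s t s, s t s t s, \<dots>\<close> of the dihedral group generated by \<open>s\<close> and \<open>t\<close>.  The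
  aim is to see that in an infinite dihedral group the set of inversions of an element is an initial
  segment of this sequence or of the one starting with \<open>t\<close>, so that it cannot contain both \<open>s\<close>
  and \<open>t\<close>.
\<close>

definition alternating :: "'a \<Rightarrow> 'a \<Rightarrow> nat \<Rightarrow> 'a" where
  "alternating s t j = (s \<otimes> t) [^] j \<otimes> s"

lemma alternating_closed: "s \<in> S \<Longrightarrow> t \<in> S \<Longrightarrow> alternating s t j \<in> carrier W"
  by (simp add: alternating_def)

lemma conj_alternating:
  assumes "s \<in> S" "t \<in> S"
  shows "s \<otimes> alternating t s j \<otimes> s = alternating s t (Suc j)"
proof -
  have "s \<otimes> (t \<otimes> s) [^] j = (s \<otimes> t) [^] j \<otimes> s"
  proof (induction j)
    case (Suc j)
    have "s \<otimes> (t \<otimes> s) [^] Suc j = s \<otimes> (t \<otimes> s) [^] j \<otimes> (t \<otimes> s)"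
      using assms by (simp add: m_assoc)
    also have "\<dots> = (s \<otimes> t) [^] Suc j \<otimes> s"
      using assms Suc by (simp add: m_assoc)
    finally show ?case .
  qed (use assms in simp)
  then have "s \<otimes> (t \<otimes> s) [^] j \<otimes> t \<otimes> s = (s \<otimes> t) [^] j \<otimes> s \<otimes> t \<otimes> s" by simp
  then show ?thesis using assms by (simp add: alternating_def m_assoc)
qed

lemma conj_alternating_Suc:
  assumes "s \<in> S" "t \<in> S"
  shows "s \<otimes> alternating s t (Suc j) \<otimes> s = alternating t s j"
  using conj_alternating[OF assms, of j] conj_gen_eq_iff[OF assms(1)] alternating_closed assms
  by (metis (no_types))

lemma infinite_order_if_not_commute:
  assumes "s \<in> S" "t \<in> S" "s \<otimes> t \<noteq> t \<otimes> s"
  shows "(s \<otimes> t) [^] Suc j \<noteq> \<one>"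
proof -
  have "ord (s \<otimes> t) = 0" using commute_if_ord[OF assms(1,2)] assms(3) by blast
  then have "\<forall>n > 0. (s \<otimes> t) [^] (n::nat) \<noteq> \<one>"
    using ord_eq_0[of "s \<otimes> t"] assms(1,2) by simp
  then show ?thesis by blast
qed

lemma alternating_neq:
  assumes "s \<in> S" "t \<in> S" "s \<otimes> t \<noteq> t \<otimes> s"
  shows "alternating s t (Suc j) \<noteq> s" "alternating s t j \<noteq> t"
proof
  assume "alternating s t (Suc j) = s"
  then have "(s \<otimes> t) [^] Suc j = \<one>"
    using assms(1,2) unfolding alternating_def by (intro r_cancel_one[THEN iffD1]) auto
  then show False using infinite_order_if_not_commute[OF assms] by blast
next
  show "alternating s t j \<noteq> t"
  proof
    assume "alternating s t j = t"
    then have "(s \<otimes> t) [^] j \<otimes> s \<otimes> t = \<one>" using assms(2) by (simp add: alternating_def)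
    then have "(s \<otimes> t) [^] Suc j = \<one>" using assms(1,2) by (simp add: m_assoc)
    then show False using infinite_order_if_not_commute[OF assms] by blast
  qed
qed

text \<open>
  Conjugation by \<open>s\<close> fixes \<open>s\<close> and maps the remaining members of the first sequence onto the second
  sequence, each index dropping by one.  Together with toggling \<open>s\<close> itself, this lengthens a segment
  of the second kind, now as one of the first kind, and shortens a segment of the first kind.
\<close>

lemma flip_alternating_segment:
  assumes "s \<in> S" "t \<in> S" "s \<otimes> t \<noteq> t \<otimes> s"
    and D: "D \<subseteq> carrier W" "\<And>r. r \<in> D \<Longrightarrow> s \<otimes> r \<otimes> s \<in> D"
    and F: "(\<forall>r \<in> D. F r \<longleftrightarrow> r \<in> alternating s t ` {..<k}) \<or>
            (\<forall>r \<in> D. F r \<longleftrightarrow> r \<in> alternating t s ` {..<k})"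
  shows "\<exists>k. (\<forall>r \<in> D. flip s F r \<longleftrightarrow> r \<in> alternating s t ` {..<k}) \<or>
             (\<forall>r \<in> D. flip s F r \<longleftrightarrow> r \<in> alternating t s ` {..<k})"
  using F
proof
  assume F: "\<forall>r \<in> D. F r \<longleftrightarrow> r \<in> alternating t s ` {..<k}"
  have "flip s F r \<longleftrightarrow> r \<in> alternating s t ` {..<Suc k}" if r: "r \<in> D" for r
  proof -
    have "s \<otimes> r \<otimes> s \<in> alternating t s ` {..<k} \<longleftrightarrow> r \<in> (\<lambda>j. alternating s t (Suc j)) ` {..<k}"
      using r D assms(1,2)
      by (auto simp: image_iff conj_gen_eq_iff alternating_closed conj_alternating subset_iff)
    moreover have "{..<Suc k} = insert 0 (Suc ` {..<k})" by (auto simp: lessThan_Suc_eq_insert_0)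
    moreover have "alternating s t 0 = s" using assms(1) by (simp add: alternating_def)
    ultimately show ?thesis
      using F r D alternating_neq(1)[OF assms(1-3)] by (auto simp: flip_def)
  qed
  then show ?thesis by blast
next
  assume F: "\<forall>r \<in> D. F r \<longleftrightarrow> r \<in> alternating s t ` {..<k}"
  have eq: "s \<otimes> r \<otimes> s \<in> alternating s t ` Suc ` {..<j} \<longleftrightarrow> r \<in> alternating t s ` {..<j}"
    if "r \<in> D" for r j
    using that D assms(1,2)
    by (auto simp: image_iff conj_gen_eq_iff alternating_closed conj_alternating_Suc subset_iff)
  have 0: "alternating s t 0 = s" using assms(1) by (simp add: alternating_def)
  show ?thesis
  proof (cases k)
    case 0
    then have "\<forall>r \<in> D. flip s F r \<longleftrightarrow> r \<in> alternating s t ` {..<1}"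
      using F D \<open>alternating s t 0 = s\<close> by (auto simp: flip_def)
    then show ?thesis by blast
  next
    case (Suc j)
    have "flip s F r \<longleftrightarrow> r \<in> alternating t s ` {..<j}" if r: "r \<in> D" for r
    proof -
      have "{..<k} = insert 0 (Suc ` {..<j})" using Suc by (auto simp: lessThan_Suc_eq_insert_0)
      moreover have "s \<otimes> r \<otimes> s = s \<longleftrightarrow> r = s"
        using conj_gen_eq_iff[of s r s] r D(1) assms(1) by auto
      moreover have "r \<noteq> s \<or> r \<notin> alternating t s ` {..<j}"
        using alternating_neq(2)[OF assms(2,1) assms(3)[symmetric]] by (metis imageE)
      ultimately show ?thesis
        using F r D(2) eq[OF r, of j] 0 by (auto simp: flip_def)
    qed
    then show ?thesis by blast
  qed
qed

lemma fold_flip_alternating_segment: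
  assumes st: "s \<in> S" "t \<in> S" "s \<otimes> t \<noteq> t \<otimes> s"
    and D: "D \<subseteq> carrier W" "\<And>x r. x \<in> {s, t} \<Longrightarrow> r \<in> D \<Longrightarrow> x \<otimes> r \<otimes> x \<in> D"
    and f: "\<And>r. r \<in> D \<Longrightarrow> \<not> f r"
    and ws: "ws \<in> lists {s, t}"
  shows "\<exists>k. (\<forall>r \<in> D. fold flip ws f r \<longleftrightarrow> r \<in> alternating s t ` {..<k}) \<or>
             (\<forall>r \<in> D. fold flip ws f r \<longleftrightarrow> r \<in> alternating t s ` {..<k})"
  using ws
proof (induction ws rule: rev_induct)
  case Nil
  have "\<forall>r \<in> D. fold flip [] f r \<longleftrightarrow> r \<in> alternating s t ` {..<0}" using f by simp
  then show ?case by blast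
next
  case (snoc x ws)
  let ?F = "fold flip ws f"
  obtain k where k: "(\<forall>r \<in> D. ?F r \<longleftrightarrow> r \<in> alternating s t ` {..<k}) \<or>
             (\<forall>r \<in> D. ?F r \<longleftrightarrow> r \<in> alternating t s ` {..<k})"
    using snoc by auto
  have x: "x = s \<or> x = t" using snoc.prems by auto
  have "\<exists>k. (\<forall>r \<in> D. flip x ?F r \<longleftrightarrow> r \<in> alternating s t ` {..<k}) \<or>
             (\<forall>r \<in> D. flip x ?F r \<longleftrightarrow> r \<in> alternating t s ` {..<k})"
    using x
  proof
    assume "x = s"
    then show ?thesis using flip_alternating_segment[OF st D(1) _ k] D(2) by simp
  next
    assume "x = t"
    moreover have "\<exists>k. (\<forall>r \<in> D. flip t ?F r \<longleftrightarrow> r \<in> alternating t s ` {..<k}) \<or>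
             (\<forall>r \<in> D. flip t ?F r \<longleftrightarrow> r \<in> alternating s t ` {..<k})"
      by (rule flip_alternating_segment[OF st(2,1) st(3)[symmetric] D(1) D(2) k[THEN disj_commute[THEN iffD1]]])
        simp_all
    ultimately show ?thesis by (simp only: disj_commute)
  qed
  then show ?case by simp
qed

text \<open>
  Let \<open>v\<close> be a shortest element of the coset \<open>w\<langle>s, t\<rangle>\<close>.  No element of \<open>\<langle>s, t\<rangle>\<close> is an inversion of
  \<open>v\<close>, since it would lead to a shorter element of the coset.  Hence on \<open>\<langle>s, t\<rangle>\<close> the inversions of \<open>w\<close>
  are those of a word in \<open>s\<close> and \<open>t\<close> only, which are known.
\<close>

theorem descents_commute:
  assumes w: "w \<in> carrier W"
    and s: "s \<in> right_descents W S w" and t: "t \<in> right_descents W S w"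
  shows "s \<otimes> t = t \<otimes> s"
proof (rule ccontr)
  assume nc: "s \<otimes> t \<noteq> t \<otimes> s"
  have S: "s \<in> S" "t \<in> S" using s t by (auto simp: right_descents_def)
  have sub: "us \<in> lists S" if "us \<in> lists {s, t}" for us
    using that S by (auto simp: in_lists_conv_set)
  define D where "D = val ` lists {s, t}"
  have D: "D \<subseteq> carrier W" "s \<in> D" "t \<in> D"
  proof -
    show "D \<subseteq> carrier W" unfolding D_def using sub val_closed by blast
    have "val [s] \<in> D" "val [t] \<in> D" unfolding D_def by (intro imageI; simp)+
    then show "s \<in> D" "t \<in> D" using S by auto
  qed
  have conj: "x \<otimes> r \<otimes> x \<in> D" if x: "x \<in> {s, t}" and r: "r \<in> D" for x r
  proof -
    obtain us where us: "us \<in> lists {s, t}" "r = val us" using r by (auto simp: D_def)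
    have "x \<in> S" using x S by auto
    then have "val (x # us @ [x]) = x \<otimes> r \<otimes> x" using us sub[OF us(1)] by (simp add: m_assoc)
    moreover have "x # us @ [x] \<in> lists {s, t}" using us x by auto
    ultimately show ?thesis unfolding D_def by (metis imageI)
  qed
  obtain vs where vs: "vs \<in> lists {s, t}"
    and min: "\<And>us. us \<in> lists {s, t} \<Longrightarrow> len (w \<otimes> val vs) \<le> len (w \<otimes> val us)"
    using ex_has_least_nat[of "\<lambda>us. us \<in> lists {s, t}" "[]" "\<lambda>us. len (w \<otimes> val us)"] by auto
  define v where "v = w \<otimes> val vs"
  have v: "v \<in> carrier W" using w vs sub by (simp add: v_def)
  have no_inv: "\<not> inversion v r" if r: "r \<in> D" for r
  proof
    assume "inversion v r"
    then have "len (v \<otimes> r) < len v" using len_inversion v r D by auto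
    moreover obtain us where us: "us \<in> lists {s, t}" "r = val us" using r by (auto simp: D_def)
    moreover have "v \<otimes> r = w \<otimes> val (vs @ us)"
      using us w vs sub by (simp add: v_def m_assoc)
    moreover have "len v \<le> len (w \<otimes> val (vs @ us))"
      unfolding v_def using us(1) vs by (intro min) auto
    ultimately show False by simp
  qed
  obtain u where u: "u \<in> lists S" "val u = v" using v word_exists by blast
  have rvs: "rev vs \<in> lists {s, t}" using vs by simp
  have "w = val (u @ rev vs)"
    using u vs sub w by (simp add: v_def val_rev m_assoc)
  then have inv_w: "inversion w r \<longleftrightarrow> fold flip (rev vs) (fold flip u (\<lambda>_. False)) r" if "r \<in> D" for r
    using inversion_val[of "u @ rev vs" r] u sub[OF rvs] that D by auto
  have no_inv_u: "\<not> fold flip u (\<lambda>_. False) r" if "r \<in> D" for r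
    using no_inv[OF that] inversion_val[of u r] u that D by auto
  have "\<exists>k. (\<forall>r \<in> D. fold flip (rev vs) (fold flip u (\<lambda>_. False)) r \<longleftrightarrow> r \<in> alternating s t ` {..<k}) \<or>
             (\<forall>r \<in> D. fold flip (rev vs) (fold flip u (\<lambda>_. False)) r \<longleftrightarrow> r \<in> alternating t s ` {..<k})"
    by (rule fold_flip_alternating_segment[OF S nc D(1) conj _ rvs]) (use no_inv_u in auto)
  then obtain k where k: "(\<forall>r \<in> D. inversion w r \<longleftrightarrow> r \<in> alternating s t ` {..<k}) \<or>
             (\<forall>r \<in> D. inversion w r \<longleftrightarrow> r \<in> alternating t s ` {..<k})"
    by (auto simp: inv_w)
  have "inversion w s" "inversion w t" using s t S w descent_iff_inversion by auto
  then have "t \<in> range (alternating s t) \<or> s \<in> range (alternating t s)"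
    using k D by blast
  then show False
    using alternating_neq(2)[OF S nc] alternating_neq(2)[OF S(2,1) nc[symmetric]] by (metis imageE)
qed

lemma len_mult_gens:
  assumes "s \<in> S" "t \<in> S" "s \<noteq> t"
  shows "len (s \<otimes> t) = 2"
proof -
  have "\<not> inversion (val [s]) t"
    using inversion_val[of "[s]" t] assms by (simp add: flip_def)
  then have "t \<notin> right_descents W S s" using descent_iff_inversion[of s t] assms by simp
  then show ?thesis using len_no_descent[of s t] assms by simp
qed

end

section \<open>Galleries and panels\<close>

context weyl_building
begin

lemma adjacent_sym:
  assumes "c \<in> Ch" "d \<in> Ch" "s \<in> S" "\<delta> c d = s"
  shows "\<delta> d c = s"
proof -
  have "\<delta> c c = \<one>" using WD1 assms by simp
  moreover have "\<delta> c c \<in> {s \<otimes> \<delta> d c, \<delta> d c}" using WD2[of d c c s] assms by simp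
  moreover have "\<delta> d c \<noteq> \<one>" using WD1[of d c] WD1[of c d] involution[of s] assms by auto
  ultimately have "s \<otimes> \<delta> d c = \<one>" by auto
  then have "s \<otimes> (s \<otimes> \<delta> d c) = s" using assms by simp
  then show ?thesis using assms dist_closed by simp
qed

primrec gallery :: "'w list \<Rightarrow> 'c \<Rightarrow> 'c \<Rightarrow> bool" where
  "gallery [] c d \<longleftrightarrow> c = d"
| "gallery (s # ws) c d \<longleftrightarrow> (\<exists>c' \<in> Ch. \<delta> c c' = s \<and> gallery ws c' d)"

lemma gallery_of_dist:
  assumes "ws \<in> lists S" "c \<in> Ch" "d \<in> Ch" "\<delta> c d = val ws"
  shows "gallery ws c d"
  using assms
proof (induction ws arbitrary: c rule: list.induct)
  case Nil
  then show ?case using WD1 by simp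
next
  case (Cons s ws)
  then have s: "s \<in> S" and ws: "ws \<in> lists S" by auto
  obtain c' where c': "c' \<in> Ch" "\<delta> c' c = s" "\<delta> c' d = s \<otimes> \<delta> c d"
    using WD3[OF Cons.prems(2,3) s] by blast
  have "\<delta> c' d = val ws" using c'(3) Cons.prems(4) s ws by simp
  then have "gallery ws c' d" using Cons.IH ws c'(1) Cons.prems(3) by simp
  moreover have "\<delta> c c' = s" using adjacent_sym[OF c'(1) Cons.prems(2) s c'(2)] .
  ultimately show ?case using c'(1) by auto
qed

text \<open>Reducedness forces the second clause of the axiom \<open>WD2\<close> in every step.\<close>

lemma dist_of_gallery:
  assumes "ws \<in> lists S" "len (val ws) = length ws" "c \<in> Ch" "d \<in> Ch" "gallery ws c d"
  shows "\<delta> c d = val ws"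
  using assms
proof (induction ws arbitrary: c rule: list.induct)
  case Nil
  then show ?case using WD1 by simp
next
  case (Cons s ws)
  then have s: "s \<in> S" and ws: "ws \<in> lists S" by auto
  obtain c' where c': "c' \<in> Ch" "\<delta> c c' = s" "gallery ws c' d" using Cons.prems(5) by auto
  have red: "len (val ws) = length ws"
    using len_gen_mult_le[of "val ws" s] len_le[OF ws] Cons.prems(2) s ws by simp
  have "\<delta> c' d = val ws" using Cons.IH[OF ws red c'(1) Cons.prems(4) c'(3)] .
  moreover have "len (s \<otimes> \<delta> c' d) = len (\<delta> c' d) + 1"
    using calculation red Cons.prems(2) by simp
  ultimately show ?case
    using WD2[OF c'(1) Cons.prems(4,3) s c'(2)] by simp
qed

lemma gallery_append:
  "c \<in> Ch \<Longrightarrow> gallery (us @ vs) c d \<longleftrightarrow> (\<exists>e \<in> Ch. gallery us c e \<and> gallery vs e d)"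
proof (induction us arbitrary: c)
  case (Cons s us)
  then show ?case by auto
qed auto

lemma gallery_rev:
  "ws \<in> lists S \<Longrightarrow> c \<in> Ch \<Longrightarrow> d \<in> Ch \<Longrightarrow> gallery ws c d \<Longrightarrow> gallery (rev ws) d c"
proof (induction ws arbitrary: c rule: list.induct)
  case (Cons s ws)
  then obtain c' where c': "c' \<in> Ch" "\<delta> c c' = s" "gallery ws c' d" by auto
  have "s \<in> S" using Cons.prems by simp
  then have "gallery [s] c' c"
    using adjacent_sym[OF Cons.prems(2) c'(1) _ c'(2)] Cons.prems(2) by simp
  moreover have "gallery (rev ws) d c'" using Cons.IH[OF _ c'(1) _ c'(3)] Cons.prems by simp
  ultimately show ?case using gallery_append[of d "rev ws" "[s]" c] Cons.prems(3) c'(1) by auto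
qed simp

text \<open>The axioms move the first argument of \<open>\<delta>\<close>; reversing a reduced gallery exchanges the arguments.\<close>

lemma dist_sym:
  assumes "c \<in> Ch" "d \<in> Ch"
  shows "\<delta> d c = inv (\<delta> c d)"
proof -
  obtain ws where ws: "ws \<in> lists S" "val ws = \<delta> c d" "length ws = len (\<delta> c d)"
    using dist_closed[OF assms] by (rule reduced_word_exists)
  have "gallery (rev ws) d c"
    using gallery_rev[OF ws(1) assms] gallery_of_dist[OF ws(1) assms] ws(2) by simp
  moreover have "len (val (rev ws)) = length (rev ws)"
    using ws dist_closed[OF assms] by (simp add: val_rev len_inv)
  ultimately have "\<delta> d c = val (rev ws)"
    using dist_of_gallery[of "rev ws" d c] ws(1) assms by simp
  then show ?thesis using ws by (simp add: val_rev)
qed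

lemma dist_right:
  assumes "x \<in> Ch" "c \<in> Ch" "d \<in> Ch" "s \<in> S" "\<delta> c d = s"
  shows "\<delta> x d \<in> {\<delta> x c \<otimes> s, \<delta> x c}"
    and "len (\<delta> x c \<otimes> s) = len (\<delta> x c) + 1 \<Longrightarrow> \<delta> x d = \<delta> x c \<otimes> s"
proof -
  have dc: "\<delta> d c = s" using adjacent_sym assms by blast
  have cl: "\<delta> x c \<in> carrier W" "\<delta> c x \<in> carrier W" using assms dist_closed by auto
  have xc: "\<delta> c x = inv (\<delta> x c)" and xd: "\<delta> x d = inv (\<delta> d x)"
    by (rule dist_sym[OF assms(1,2)], rule dist_sym[OF assms(3,1)])
  have e: "inv (s \<otimes> \<delta> c x) = \<delta> x c \<otimes> s" using cl assms(4) by (simp add: xc inv_mult_group)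
  have 2: "\<delta> d x \<in> {s \<otimes> \<delta> c x, \<delta> c x} \<and>
      (len (s \<otimes> \<delta> c x) = len (\<delta> c x) + 1 \<longrightarrow> \<delta> d x = s \<otimes> \<delta> c x)"
    using WD2[OF assms(2,1,3,4) dc] .
  then show "\<delta> x d \<in> {\<delta> x c \<otimes> s, \<delta> x c}"
    using e xd xc cl by auto
  assume "len (\<delta> x c \<otimes> s) = len (\<delta> x c) + 1"
  then have "len (s \<otimes> \<delta> c x) = len (\<delta> c x) + 1"
    using e len_inv[of "s \<otimes> \<delta> c x"] len_inv[of "\<delta> x c"] cl assms(4) xc by simp
  then show "\<delta> x d = \<delta> x c \<otimes> s" using 2 e xd by simp
qed

lemma exists_adjacent:
  assumes "x \<in> Ch" "c \<in> Ch" "s \<in> S"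
  obtains d where "d \<in> Ch" "\<delta> c d = s" "\<delta> x d = \<delta> x c \<otimes> s"
proof -
  obtain d where d: "d \<in> Ch" "\<delta> d c = s" "\<delta> d x = s \<otimes> \<delta> c x"
    using WD3[OF assms(2,1,3)] by blast
  have "\<delta> x d = inv (s \<otimes> \<delta> c x)" using dist_sym[OF d(1) assms(1)] d(3) by simp
  also have "\<dots> = \<delta> x c \<otimes> s"
    using dist_sym[OF assms(2,1)] dist_closed[OF assms(2,1)] assms(3) by (simp add: inv_mult_group)
  finally show thesis using that d adjacent_sym[OF d(1) assms(2,3) d(2)] by blast
qed

text \<open>The image of a reduced gallery is a gallery of the same type, and reduced galleries measure \<open>\<delta>\<close>.\<close>

lemma dist_preserved_if_adjacency_preserved:
  assumes g: "\<And>c. c \<in> Ch \<Longrightarrow> g c \<in> Ch"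
    and adj: "\<And>c d s. c \<in> Ch \<Longrightarrow> d \<in> Ch \<Longrightarrow> s \<in> S \<Longrightarrow> \<delta> c d = s \<Longrightarrow> \<delta> (g c) (g d) = s"
    and "c \<in> Ch" "d \<in> Ch"
  shows "\<delta> (g c) (g d) = \<delta> c d"
proof -
  have image: "gallery ws c d \<Longrightarrow> gallery ws (g c) (g d)" if "ws \<in> lists S" "c \<in> Ch" for ws c
    using that
  proof (induction ws arbitrary: c rule: list.induct)
    case (Cons s ws)
    then obtain c' where c': "c' \<in> Ch" "\<delta> c c' = s" "gallery ws c' d" by auto
    have "gallery ws (g c') (g d)" using Cons.IH[OF c'(3)] Cons.prems(2) c'(1) by simp
    moreover have "\<delta> (g c) (g c') = s" using adj[OF _ c'(1) _ c'(2)] Cons.prems by simp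
    ultimately show ?case using g[OF c'(1)] by auto
  qed simp
  obtain ws where ws: "ws \<in> lists S" "val ws = \<delta> c d" "length ws = len (\<delta> c d)"
    using dist_closed[OF assms(3,4)] by (rule reduced_word_exists)
  have "gallery ws (g c) (g d)"
    using image[OF ws(1) assms(3)] gallery_of_dist[OF ws(1) assms(3,4)] ws(2) by simp
  then show ?thesis using dist_of_gallery[of ws "g c" "g d"] ws g assms by simp
qed

lemma adjacent_neq: "c \<in> Ch \<Longrightarrow> s \<in> S \<Longrightarrow> \<delta> c c \<noteq> s"
  using WD1 involution by auto

lemma panel_refl [simp]: "c \<in> Ch \<Longrightarrow> c \<in> panel Ch \<delta> s c"
  by (simp add: panel_def)

lemma panel_sym:
  assumes "c \<in> Ch" "s \<in> S" "d \<in> panel Ch \<delta> s c"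
  shows "c \<in> panel Ch \<delta> s d"
  using assms adjacent_sym[of c d s] by (auto simp: panel_def)

lemma panel_trans:
  assumes "c \<in> Ch" "s \<in> S" "d \<in> panel Ch \<delta> s c" "e \<in> panel Ch \<delta> s d"
  shows "e \<in> panel Ch \<delta> s c"
proof -
  have Ch: "d \<in> Ch" "e \<in> Ch" using assms by (auto simp: panel_def)
  show ?thesis
  proof (cases "d = c \<or> e = d")
    case False
    then have "\<delta> c d = s" "\<delta> d e = s" using assms by (auto simp: panel_def)
    then have "\<delta> c e \<in> {\<one>, s}" using WD2[of d e c s] assms Ch by auto
    then show ?thesis using WD1[of c e] assms Ch by (auto simp: panel_def)
  qed (use assms in auto)
qed

lemma panel_eq:
  assumes "c \<in> Ch" "s \<in> S" "d \<in> panel Ch \<delta> s c"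
  shows "panel Ch \<delta> s d = panel Ch \<delta> s c"
proof -
  have d: "d \<in> Ch" using assms by (auto simp: panel_def)
  show ?thesis
    using panel_trans[OF assms] panel_trans[OF d assms(2) panel_sym[OF assms]] by blast
qed

lemma adjacent_iff_panel:
  assumes "c \<in> Ch" "s \<in> S"
  shows "d \<in> Ch \<and> \<delta> c d = s \<longleftrightarrow> d \<in> panel Ch \<delta> s c \<and> d \<noteq> c"
  using assms adjacent_neq by (auto simp: panel_def)

lemma panel_Int_panel:
  assumes "s \<in> S" "t \<in> S" "s \<noteq> t" "c \<in> Ch" "d \<in> panel Ch \<delta> s c" "d \<in> panel Ch \<delta> t c"
  shows "d = c"
  using assms by (auto simp: panel_def)

end

section \<open>Chambers described by colours\<close>

text \<open>
  With one directed legal colouring per generator, a chamber has the neighbours \<open>nbr s i c\<close>, one for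
  each type \<open>s\<close> and colour \<open>i\<close>.  Everything later is expressed by these neighbours, the colours and
  the descents of chambers.
\<close>

locale colored_building = semiregular_right_angled_building W S Ch \<delta> q
  for W :: "('w, 'm) monoid_scheme" (structure) and S :: "'w set"
    and Ch :: "'c set" and \<delta> :: "'c \<Rightarrow> 'c \<Rightarrow> 'w" and q :: "'w \<Rightarrow> nat" +
  fixes c0 :: 'c and h :: "'w \<Rightarrow> 'c \<Rightarrow> nat"
  assumes base [simp]: "c0 \<in> Ch"
    and coloring: "s \<in> S \<Longrightarrow> directed_legal_coloring W S Ch \<delta> q c0 s (h s)"
begin

abbreviation pan :: "'w \<Rightarrow> 'c \<Rightarrow> 'c set" where "pan \<equiv> panel Ch \<delta>"

definition nbr :: "'w \<Rightarrow> nat \<Rightarrow> 'c \<Rightarrow> 'c" where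
  "nbr s i c = inv_into (pan s c) (h s) i"

text \<open>The types of the panels through \<open>c\<close> on which \<open>c\<close> is not the chamber closest to \<open>c0\<close>.\<close>

definition descents :: "'c \<Rightarrow> 'w set" where
  "descents c = right_descents W S (\<delta> c0 c)"

definition depth :: "'c \<Rightarrow> nat" where
  "depth c = len (\<delta> c0 c)"

lemma base_dist_closed [simp]: "c \<in> Ch \<Longrightarrow> \<delta> c0 c \<in> carrier W"
  using dist_closed by simp

lemma descents_gen: "s \<in> descents c \<Longrightarrow> s \<in> S"
  by (simp add: descents_def right_descents_def)

lemma depth_eq_0: "c \<in> Ch \<Longrightarrow> depth c = 0 \<longleftrightarrow> c = c0"
  using WD1[of c0 c] len_eq_0_iff by (auto simp: depth_def)

lemma descents_commuting:
  "c \<in> Ch \<Longrightarrow> s \<in> descents c \<Longrightarrow> t \<in> descents c \<Longrightarrow> s \<otimes> t = t \<otimes> s"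
  using descents_commute[of "\<delta> c0 c" s t] by (simp add: descents_def)

lemma exists_descent:
  assumes "c \<in> Ch" "c \<noteq> c0"
  obtains s where "s \<in> descents c"
proof -
  obtain ws where ws: "ws \<in> lists S" "val ws = \<delta> c0 c" "length ws = depth c"
    using base_dist_closed[OF assms(1)] unfolding depth_def by (rule reduced_word_exists)
  have "ws \<noteq> []" using ws(3) depth_eq_0 assms by auto
  then obtain us s where us: "ws = us @ [s]" by (metis rev_exhaust)
  then have "\<delta> c0 c \<otimes> s = val us" using ws by (auto simp flip: ws(2) simp: m_assoc)
  then have "len (\<delta> c0 c \<otimes> s) < depth c" using len_le[of us] ws us by auto
  then have "s \<in> descents c" using ws us by (auto simp: descents_def right_descents_def depth_def)
  then show thesis by (rule that)
qed

lemma weak_coloring: "s \<in> S \<Longrightarrow> weak_legal_coloring W S Ch \<delta> q s (h s)"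
  using coloring by (simp add: directed_legal_coloring_def)

lemma color_bij:
  assumes "s \<in> S" "c \<in> Ch"
  shows "bij_betw (h s) (pan s c) {1..q s}"
  using weak_coloring[OF assms(1)] assms(2) by (simp add: weak_legal_coloring_def panels_def)

lemma color_range: "s \<in> S \<Longrightarrow> c \<in> Ch \<Longrightarrow> h s c \<in> {1..q s}"
  using color_bij[of s c] panel_refl[of c s] by (meson bij_betwE)

lemma panel_chamber: "d \<in> pan s c \<Longrightarrow> d \<in> Ch"
  by (simp add: panel_def)

lemma panel_color_eq:
  assumes "s \<in> S" "c \<in> Ch" "d \<in> pan s c" "e \<in> pan s c" "h s d = h s e"
  shows "d = e"
  using color_bij[OF assms(1,2)] assms(3-5) by (auto simp: bij_betw_def inj_on_def)

lemma nbr_panel: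
  assumes "s \<in> S" "c \<in> Ch" "i \<in> {1..q s}"
  shows "nbr s i c \<in> pan s c" "h s (nbr s i c) = i"
  using color_bij[OF assms(1,2)] assms(3)
  by (auto simp: nbr_def bij_betw_def inv_into_into f_inv_into_f simp del: atLeastAtMost_iff)

lemma nbr_eqI:
  assumes "s \<in> S" "c \<in> Ch" "d \<in> pan s c" "h s d = i"
  shows "nbr s i c = d"
  using color_bij[OF assms(1,2)] assms(3,4) by (auto simp: nbr_def bij_betw_def)

lemma nbr_chamber: "s \<in> S \<Longrightarrow> c \<in> Ch \<Longrightarrow> i \<in> {1..q s} \<Longrightarrow> nbr s i c \<in> Ch"
  using nbr_panel panel_chamber by blast

lemma nbr_cong:
  "s \<in> S \<Longrightarrow> c \<in> Ch \<Longrightarrow> d \<in> pan s c \<Longrightarrow> nbr s i d = nbr s i c"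
  using panel_eq[of c s d] by (simp add: nbr_def)

lemma one_color: "s \<in> S \<Longrightarrow> 1 \<in> {1..q s}"
  using thick[of s] by simp

lemma commuting_corner:
  assumes st: "s \<in> S" "t \<in> S" "s \<noteq> t" and Ch: "a \<in> Ch" "b \<in> Ch" "c \<in> Ch"
    and "\<delta> a b = s" "\<delta> a c = t"
  shows "\<delta> b c = s \<otimes> t"
proof -
  have "\<delta> b a = s" by (rule adjacent_sym[OF Ch(1,2) st(1) assms(7)])
  then show ?thesis using WD2[OF Ch(1,3,2) st(1)] len_mult_gens[OF st] assms(8) st(2) by simp
qed

lemma panel_depth:
  assumes s: "s \<in> S" and c: "c \<in> Ch" "s \<notin> descents c" and d: "d \<in> pan s c" "d \<noteq> c"
  shows "\<delta> c0 d = \<delta> c0 c \<otimes> s" "depth d = depth c + 1" "s \<in> descents d"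
proof -
  have "len (\<delta> c0 c \<otimes> s) = len (\<delta> c0 c) + 1"
    using len_no_descent[of "\<delta> c0 c" s] s c by (simp add: descents_def)
  then show 1: "\<delta> c0 d = \<delta> c0 c \<otimes> s"
    using dist_right(2)[of c0 c d s] s c d adjacent_iff_panel[of c s d] by simp
  then show "depth d = depth c + 1" using \<open>len _ = _\<close> by (simp add: depth_def)
  show "s \<in> descents d"
    using 1 descent_mult_self[of "\<delta> c0 c" s] s c by (simp add: descents_def)
qed

lemma panel_bottom_exists:
  assumes "s \<in> S" "c \<in> Ch"
  obtains b where "b \<in> pan s c" "s \<notin> descents b"
proof (cases "s \<in> descents c")
  case True
  obtain d where d: "d \<in> Ch" "\<delta> c d = s" "\<delta> c0 d = \<delta> c0 c \<otimes> s"
    using exists_adjacent[OF base assms(2,1)] by blast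
  then have "s \<notin> descents d"
    using True descent_mult_self[of "\<delta> c0 c" s] assms by (simp add: descents_def)
  moreover have "d \<in> pan s c" using d by (simp add: panel_def)
  ultimately show ?thesis using that by blast
next
  case False
  then show ?thesis using that[of c] assms by simp
qed

text \<open>
  A panel has exactly one chamber without descent along it, all others being one step further from
  \<open>c0\<close>; so this chamber is the projection of \<open>c0\<close>, to which a directed colouring gives the colour \<open>1\<close>.
\<close>

lemma color_one_iff:
  assumes s: "s \<in> S" and c: "c \<in> Ch"
  shows "h s c = 1 \<longleftrightarrow> s \<notin> descents c"
proof -
  obtain b where b: "b \<in> pan s c" "s \<notin> descents b" using panel_bottom_exists assms by blast
  have bCh: "b \<in> Ch" using b panel_chamber by blast
  have pan: "pan s b = pan s c" using panel_eq[OF c s b(1)] .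
  have "is_arg_min (\<lambda>x. len (\<delta> c0 x)) (\<lambda>x. x \<in> pan s c) d \<longleftrightarrow> d = b" for d
  proof
    assume d: "is_arg_min (\<lambda>x. len (\<delta> c0 x)) (\<lambda>x. x \<in> pan s c) d"
    then have "\<not> depth b < depth d" "d \<in> pan s c" using b by (auto simp: is_arg_min_def depth_def)
    then show "d = b" using panel_depth(2)[OF s bCh b(2), of d] pan by force
  next
    assume "d = b"
    then show "is_arg_min (\<lambda>x. len (\<delta> c0 x)) (\<lambda>x. x \<in> pan s c) d"
      using panel_depth(2)[OF s bCh b(2)] pan b by (force simp: is_arg_min_def depth_def)
  qed
  then have "proj W S \<delta> (pan s c) c0 = b" by (simp add: proj_def)
  then have "h s b = 1"
    using coloring[OF s] c by (auto simp: directed_legal_coloring_def panels_def)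
  then have "h s c = 1 \<longleftrightarrow> c = b"
    using panel_color_eq[OF s c panel_refl[OF c] b(1)] by auto
  also have "\<dots> \<longleftrightarrow> s \<notin> descents c"
    using panel_depth(3)[OF s bCh b(2), of c] pan b(2) c by auto
  finally show ?thesis .
qed

text \<open>
  The \<open>s\<close>-panels of two \<open>t\<close>-adjacent chambers lie in a common tree-wall.  The other chambers of the
  panel of \<open>d\<close> have distance \<open>t s\<close> from \<open>c\<close>, of length \<open>2\<close>, so \<open>d\<close> is the projection of \<open>c\<close>.
\<close>

lemma color_commuting:
  assumes st: "s \<in> S" "t \<in> S" "s \<noteq> t" "s \<otimes> t = t \<otimes> s"
    and c: "c \<in> Ch" and d: "d \<in> pan t c"
  shows "h s d = h s c"
proof (cases "d = c")
  case False
  have dCh: "d \<in> Ch" using d panel_chamber by blast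
  have cd: "\<delta> c d = t" using adjacent_iff_panel[OF c st(2)] d False by blast
  let ?J = "{s} \<union> {t \<in> S - {s}. t \<otimes> s = s \<otimes> t}"
  have step: "(x, y) \<in> {(x, y). x \<in> Ch \<and> y \<in> Ch \<and> \<delta> x y \<in> ?J}\<^sup>*"
    if "u \<in> ?J" "x \<in> Ch" "y \<in> pan u x" for u x y
    using that by (cases "y = x") (auto simp: panel_def intro!: r_into_rtrancl)
  have t: "t \<in> ?J" using st by auto
  have 1: "pan s c \<subseteq> residue Ch \<delta> ?J c"
    using step[of s c] c by (auto simp: residue_def)
  have 2: "pan s d \<subseteq> residue Ch \<delta> ?J c"
  proof
    fix y assume y: "y \<in> pan s d"
    show "y \<in> residue Ch \<delta> ?J c"
      unfolding residue_def using step[OF t c d] step[of s d y] y dCh by (auto intro: rtrancl_trans)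
  qed
  have wall: "common_tree_wall W S Ch \<delta> s (pan s c) (pan s d)"
    unfolding common_tree_wall_def Let_def using 1 2 c by blast
  have far: "len (\<delta> c y) = 2" if y: "y \<in> pan s d" "y \<noteq> d" for y
  proof -
    have "\<delta> d c = t" "\<delta> d y = s" "y \<in> Ch"
      using adjacent_sym[OF c dCh st(2) cd] y by (auto simp: panel_def)
    then have "\<delta> c y = t \<otimes> s" using commuting_corner[OF st(2,1) st(3)[symmetric] dCh c] by simp
    then show ?thesis using len_mult_gens[OF st(2,1)] st(3) by simp
  qed
  have "is_arg_min (\<lambda>x. len (\<delta> c x)) (\<lambda>x. x \<in> pan s d) e \<longleftrightarrow> e = d" for e
  proof -
    have "len (\<delta> c d) = 1" using cd st(2) by simp
    then show ?thesis
      using far[of e] far panel_refl[OF dCh, of s] unfolding is_arg_min_def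
      by (metis less_numeral_extra(4) one_less_numeral_iff semiring_norm(76) less_not_sym)
  qed
  then have "proj W S \<delta> (pan s d) c = d" by (simp add: proj_def)
  then show ?thesis
    using weak_coloring[OF st(1)] wall c dCh unfolding weak_legal_coloring_def panels_def by force
qed simp

text \<open>
  The chambers \<open>nbr s i c\<close> and \<open>nbr t j c\<close> have distance \<open>s t = t s\<close>.  Hence they are joined by
  a gallery of type \<open>t s\<close>, whose middle chamber closes the square; its colours are known because
  each of its two sides preserves one of them.
\<close>

lemma nbr_commute:
  assumes st: "s \<in> S" "t \<in> S" "s \<noteq> t" "s \<otimes> t = t \<otimes> s"
    and c: "c \<in> Ch" and i: "i \<in> {1..q s}" and j: "j \<in> {1..q t}"
  shows "nbr s i (nbr t j c) = nbr t j (nbr s i c)"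
proof -
  let ?b = "nbr s i c" and ?d = "nbr t j c"
  have bp: "?b \<in> pan s c" and dp: "?d \<in> pan t c" and hb: "h s ?b = i" and hd: "h t ?d = j"
    using nbr_panel st c i j by auto
  have bd: "?b \<in> Ch" "?d \<in> Ch" using bp dp panel_chamber by auto
  show ?thesis
  proof (cases "?b = c \<or> ?d = c")
    case True
    then show ?thesis
    proof
      assume "?b = c"
      moreover have "h s ?d = i" using color_commuting[OF st c dp] hb calculation by simp
      then have "nbr s i ?d = ?d" using nbr_eqI[of s ?d ?d] st bd by simp
      ultimately show ?thesis by simp
    next
      assume "?d = c"
      moreover have "h t ?b = j"
        using color_commuting[OF st(2,1) st(3)[symmetric] st(4)[symmetric] c bp] hd calculation by simp
      then have "nbr t j ?b = ?b" using nbr_eqI[of t ?b ?b] st bd by simp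
      ultimately show ?thesis by simp
    qed
  next
    case False
    then have "\<delta> c ?b = s" "\<delta> c ?d = t" using bp dp by (auto simp: panel_def)
    then have "\<delta> ?b ?d = val [t, s]"
      using commuting_corner[OF st(1-3) c bd] st by simp
    then have "gallery [t, s] ?b ?d" using gallery_of_dist[of "[t, s]" ?b ?d] st(1,2) bd by simp
    then obtain x where x: "x \<in> Ch" "\<delta> ?b x = t" "\<delta> x ?d = s" using bd by auto
    have xb: "x \<in> pan t ?b" and xd: "x \<in> pan s ?d"
      using x panel_sym[OF x(1) st(1), of ?d] bd by (auto simp: panel_def)
    have "h s x = i" using color_commuting[OF st bd(1) xb] hb by simp
    moreover have "h t x = j"
      using color_commuting[OF st(2,1) st(3)[symmetric] st(4)[symmetric] bd(2) xd] hd by simp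
    ultimately have "nbr s i ?d = x" "nbr t j ?b = x" using nbr_eqI st bd xb xd by auto
    then show ?thesis by simp
  qed
qed

text \<open>By \<open>color_one_iff\<close> the neighbour of colour \<open>1\<close> is the chamber of the panel closest to \<open>c0\<close>.\<close>

abbreviation down :: "'w \<Rightarrow> 'c \<Rightarrow> 'c" where "down s \<equiv> nbr s 1"

lemma down:
  assumes "c \<in> Ch" "s \<in> descents c"
  shows "down s c \<in> Ch" "c \<in> pan s (down s c)" "s \<notin> descents (down s c)"
    "depth c = depth (down s c) + 1" "\<delta> c0 c = \<delta> c0 (down s c) \<otimes> s"
proof -
  have s: "s \<in> S" using assms descents_gen by blast
  have p: "down s c \<in> pan s c" "h s (down s c) = 1" using nbr_panel[OF s assms(1) one_color[OF s]] by auto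
  show Ch: "down s c \<in> Ch" using p panel_chamber by blast
  show up: "c \<in> pan s (down s c)" using panel_sym[OF assms(1) s p(1)] .
  show nd: "s \<notin> descents (down s c)" using color_one_iff[OF s Ch] p by simp
  have "c \<noteq> down s c" using nd assms by auto
  then show "depth c = depth (down s c) + 1" "\<delta> c0 c = \<delta> c0 (down s c) \<otimes> s"
    using panel_depth[OF s Ch nd up] by auto
qed

lemma down_descents_commuting:
  assumes c: "c \<in> Ch" "s \<in> descents c" and t: "t \<in> S" "s \<noteq> t" "s \<otimes> t = t \<otimes> s"
  shows "t \<in> descents (down s c) \<longleftrightarrow> t \<in> descents c"
proof -
  have s: "s \<in> S" using c descents_gen by blast
  have "h t c = h t (down s c)"
    using color_commuting[OF t(1) s t(2)[symmetric] t(3)[symmetric] down(1)[OF c] down(2)[OF c]] .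
  then show ?thesis using color_one_iff[OF t(1)] c(1) down(1)[OF c] by metis
qed

section \<open>Automorphisms fixing the base chamber and their local actions\<close>

abbreviation lact :: "'w \<Rightarrow> 'c \<Rightarrow> ('c \<Rightarrow> 'c) \<Rightarrow> nat \<Rightarrow> nat" where
  "lact \<equiv> local_action Ch \<delta> q h"

definition based_aut :: "('c \<Rightarrow> 'c) \<Rightarrow> bool" where
  "based_aut g \<longleftrightarrow> g \<in> building_auts Ch \<delta> \<and> g c0 = c0"

lemma lact_apply: "i \<in> {1..q s} \<Longrightarrow> lact s c g i = h s (g (nbr s i c))"
  by (simp add: local_action_def nbr_def)

lemma lact_outside: "i \<notin> {1..q s} \<Longrightarrow> lact s c g i = i"
  unfolding local_action_def by (simp only: if_False)

lemma aut_bij: "based_aut g \<Longrightarrow> bij_betw g Ch Ch"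
  by (simp add: based_aut_def building_auts_def Bij_def)

lemma aut_chamber: "based_aut g \<Longrightarrow> c \<in> Ch \<Longrightarrow> g c \<in> Ch"
  using aut_bij bij_betwE by blast

lemma aut_dist: "based_aut g \<Longrightarrow> c \<in> Ch \<Longrightarrow> d \<in> Ch \<Longrightarrow> \<delta> (g c) (g d) = \<delta> c d"
  by (simp add: based_aut_def building_auts_def)

lemma aut_base_dist: "based_aut g \<Longrightarrow> c \<in> Ch \<Longrightarrow> \<delta> c0 (g c) = \<delta> c0 c"
  using aut_dist[of g c0 c] by (simp add: based_aut_def)

lemma aut_depth: "based_aut g \<Longrightarrow> c \<in> Ch \<Longrightarrow> depth (g c) = depth c"
  by (simp add: depth_def aut_base_dist)

lemma aut_descents: "based_aut g \<Longrightarrow> c \<in> Ch \<Longrightarrow> descents (g c) = descents c"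
  by (simp add: descents_def aut_base_dist)

lemma aut_panel:
  "based_aut g \<Longrightarrow> c \<in> Ch \<Longrightarrow> d \<in> pan s c \<Longrightarrow> g d \<in> pan s (g c)"
  using aut_dist[of g c d] aut_chamber[of g d] by (auto simp: panel_def)

lemma aut_nbr:
  assumes "based_aut g" "s \<in> S" "c \<in> Ch" "i \<in> {1..q s}"
  shows "g (nbr s i c) = nbr s (lact s c g i) (g c)"
proof -
  have "nbr s i c \<in> pan s c" using nbr_panel assms by blast
  then have "g (nbr s i c) \<in> pan s (g c)" using aut_panel assms by blast
  then show ?thesis
    using nbr_eqI[of s "g c" "g (nbr s i c)"] aut_chamber assms lact_apply by metis
qed

lemma lact_one:
  assumes "based_aut g" "s \<in> S" "c \<in> Ch"
  shows "lact s c g 1 = 1"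
proof -
  let ?b = "nbr s 1 c"
  have b: "?b \<in> Ch" "h s ?b = 1" using nbr_panel[OF assms(2,3) one_color] nbr_chamber one_color assms by auto
  then have "s \<notin> descents (g ?b)" using color_one_iff[of s ?b] aut_descents assms by simp
  then have "h s (g ?b) = 1" using color_one_iff[of s "g ?b"] aut_chamber b assms by simp
  then show ?thesis using lact_apply[OF one_color] assms by simp
qed

text \<open>
  Constancy on the \<open>s\<close>-tree-walls: their chambers are connected by adjacencies of the types that
  commute with \<open>s\<close>, the case \<open>t = s\<close> included.
\<close>

definition wall_invariant :: "('c \<Rightarrow> 'w \<Rightarrow> 'x) \<Rightarrow> bool" where
  "wall_invariant \<sigma> \<longleftrightarrow>
    (\<forall>s \<in> S. \<forall>t \<in> S. \<forall>c \<in> Ch. \<forall>d \<in> pan t c. s \<otimes> t = t \<otimes> s \<longrightarrow> \<sigma> d s = \<sigma> c s)"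

lemma wall_invariantD:
  "wall_invariant \<sigma> \<Longrightarrow> s \<in> S \<Longrightarrow> t \<in> S \<Longrightarrow> s \<otimes> t = t \<otimes> s \<Longrightarrow> c \<in> Ch \<Longrightarrow> d \<in> pan t c \<Longrightarrow>
    \<sigma> d s = \<sigma> c s"
  unfolding wall_invariant_def by blast

text \<open>
  For \<open>t \<noteq> s\<close>, chambers of the same \<open>s\<close>-colour on the two parallel panels are \<open>t\<close>-adjacent; so are
  their images, which therefore have the same \<open>s\<close>-colour again.
\<close>

lemma wall_invariant_lact:
  assumes g: "based_aut g"
  shows "wall_invariant (\<lambda>c s. lact s c g)"
  unfolding wall_invariant_def
proof (intro ballI impI)
  fix s t c d
  assume st: "s \<in> S" "t \<in> S" "s \<otimes> t = t \<otimes> s" and c: "c \<in> Ch" and d: "d \<in> pan t c"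
  have dCh: "d \<in> Ch" using d panel_chamber by blast
  show "lact s d g = lact s c g"
  proof (cases "s = t")
    case True
    then show ?thesis using panel_eq[OF c st(2) d] by (simp add: local_action_def fun_eq_iff)
  next
    case False
    have "lact s d g i = lact s c g i" if i: "i \<in> {1..q s}" for i
    proof -
      let ?c = "nbr s i c" and ?d = "nbr s i d"
      have cr: "h t d \<in> {1..q t}" using color_range st dCh by simp
      have "?d = nbr t (h t d) ?c"
        using nbr_commute[OF st(1,2) False st(3) c i cr] nbr_eqI[OF st(2) c d HOL.refl] by simp
      moreover have cc: "?c \<in> Ch" using nbr_chamber[OF st(1) c i] .
      ultimately have "?d \<in> pan t ?c" using nbr_panel(1)[OF st(2) cc cr] by simp
      then have "g ?d \<in> pan t (g ?c)" using aut_panel g cc by blast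
      then have "h s (g ?d) = h s (g ?c)"
        using color_commuting[OF st(1,2) False st(3)] aut_chamber g cc by blast
      then show ?thesis using lact_apply i by simp
    qed
    then show ?thesis using lact_outside by (metis ext)
  qed
qed

text \<open>
  A chamber other than \<open>c0\<close> lies on the panel of a chamber below it, and its image is the neighbour
  of the image of that chamber whose colour is prescribed by the local action.
\<close>

lemma aut_eq_on_ball:
  assumes g: "based_aut g" "based_aut g'"
    and eq: "\<And>c s. c \<in> Ch \<Longrightarrow> depth c < n \<Longrightarrow> s \<in> S \<Longrightarrow> lact s c g = lact s c g'"
    and c: "c \<in> Ch" "depth c \<le> n"
  shows "g c = g' c"
  using c
proof (induction "depth c" arbitrary: c rule: less_induct)
  case less
  show ?case
  proof (cases "c = c0")
    case True
    then show ?thesis using g by (simp add: based_aut_def)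
  next
    case False
    then obtain s where sd: "s \<in> descents c" using exists_descent less.prems by blast
    then have s: "s \<in> S" using descents_gen by blast
    note b = down[OF less.prems(1) sd]
    have c_eq: "nbr s (h s c) (down s c) = c" using nbr_eqI[OF s b(1,2)] by simp
    have cr: "h s c \<in> {1..q s}" using color_range s less.prems by simp
    have "g (down s c) = g' (down s c)" using less.hyps[of "down s c"] b less.prems(2) by simp
    moreover have "lact s (down s c) g = lact s (down s c) g'"
      using eq[OF b(1) _ s] b(4) less.prems(2) by simp
    ultimately show ?thesis
      using aut_nbr[OF g(1) s b(1) cr] aut_nbr[OF g(2) s b(1) cr] c_eq by simp
  qed
qed

section \<open>Automorphisms with prescribed local actions\<close>

text \<open>
  The only candidate for an automorphism with local actions \<open>\<sigma>\<close>: a chamber is reached from below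
  along an arbitrarily chosen descent, and its image along the same type with the colour changed by
  \<open>\<sigma>\<close>.  That the choice does not matter is the last claim of \<open>twist_properties\<close>.
\<close>

function twist :: "('c \<Rightarrow> 'w \<Rightarrow> nat \<Rightarrow> nat) \<Rightarrow> 'c \<Rightarrow> 'c" where
  "twist \<sigma> c = (if c \<in> Ch \<and> c \<noteq> c0
     then let s = SOME s. s \<in> descents c in nbr s (\<sigma> c s (h s c)) (twist \<sigma> (down s c)) else c)"
  by pat_completeness auto
termination
proof (relation "measure (depth \<circ> snd)")
  fix \<sigma> :: "'c \<Rightarrow> 'w \<Rightarrow> nat \<Rightarrow> nat" and c s
  assume c: "c \<in> Ch \<and> c \<noteq> c0" and s: "s = (SOME s. s \<in> descents c)"
  have "s \<in> descents c" unfolding s using exists_descent c by (metis someI)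
  then show "((\<sigma>, down s c), \<sigma>, c) \<in> measure (depth \<circ> snd)" using down(4) c by simp
qed simp

declare twist.simps [simp del]

lemma twist_step:
  assumes "c \<in> Ch" "c \<noteq> c0"
  obtains s where "s \<in> descents c" "twist \<sigma> c = nbr s (\<sigma> c s (h s c)) (twist \<sigma> (down s c))"
proof -
  have "(SOME s. s \<in> descents c) \<in> descents c" using exists_descent assms by (metis someI)
  then show thesis using that twist.simps[of \<sigma> c] assms by (simp add: Let_def)
qed

text \<open>
  All three claims are proved together by induction on the distance to \<open>c0\<close>.  Let \<open>s\<close> be the descent
  chosen for \<open>c\<close>.  The colour of the image for a type \<open>r\<close> commuting with \<open>s\<close> is inherited from
  the chamber below.  If \<open>r\<close> does not commute with \<open>s\<close>, then, as descents commute, it is a descent neither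
  of \<open>c\<close> nor of its image, so both have \<open>r\<close>-colour \<open>1\<close>; here \<open>\<sigma> c r 1 = 1\<close> enters.  For another
  descent \<open>t\<close>, the chambers below \<open>c\<close> along \<open>s\<close> and \<open>t\<close> have a common chamber \<open>?u\<close> below them, and the
  image square closes up by \<open>nbr_commute\<close>.
\<close>

lemma twist_properties:
  assumes inv: "wall_invariant \<sigma>"
    and perm: "\<And>c s. c \<in> Ch \<Longrightarrow> s \<in> S \<Longrightarrow> \<sigma> c s permutes {1..q s}"
    and one: "\<And>c s. c \<in> Ch \<Longrightarrow> s \<in> S \<Longrightarrow> \<sigma> c s 1 = 1"
    and "c \<in> Ch"
  shows "twist \<sigma> c \<in> Ch \<and> (\<forall>s \<in> S. h s (twist \<sigma> c) = \<sigma> c s (h s c)) \<and>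
    (\<forall>s \<in> descents c. twist \<sigma> c \<in> pan s (twist \<sigma> (down s c)))"
  using \<open>c \<in> Ch\<close>
proof (induction "depth c" arbitrary: c rule: less_induct)
  case less
  note c = less.prems
  show ?case
  proof (cases "c = c0")
    case True
    have nd: "descents c0 = {}" using down(4)[OF base] depth_eq_0[OF base] by force
    have "h s c0 = 1" if "s \<in> S" for s using color_one_iff[OF that base] nd by simp
    then show ?thesis using True nd one[OF base] by (simp add: twist.simps)
  next
    case False
    then obtain s where sd: "s \<in> descents c"
      and tw: "twist \<sigma> c = nbr s (\<sigma> c s (h s c)) (twist \<sigma> (down s c))"
      using twist_step c by blast
    have s: "s \<in> S" using sd descents_gen by blast
    let ?j = "\<sigma> c s (h s c)" and ?b = "down s c"
    note b = down[OF c sd]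
    have cr: "h r x \<in> {1..q r}" if "r \<in> S" "x \<in> Ch" for r x using that color_range by blast
    have j: "?j \<in> {1..q s}" using permutes_in_image[OF perm[OF c s]] cr[OF s c] by blast
    have IH: "twist \<sigma> x \<in> Ch" "\<And>r. r \<in> S \<Longrightarrow> h r (twist \<sigma> x) = \<sigma> x r (h r x)"
      "\<And>r. r \<in> descents x \<Longrightarrow> twist \<sigma> x \<in> pan r (twist \<sigma> (down r x))"
      if "x \<in> Ch" "depth x < depth c" for x
      using less.hyps[OF that(2,1)] by blast+
    note IHb = IH[OF b(1)]
    have bCh: "twist \<sigma> ?b \<in> Ch" using IHb b(4) by simp
    have in_pan: "twist \<sigma> c \<in> pan s (twist \<sigma> ?b)" and hs: "h s (twist \<sigma> c) = ?j"
      using nbr_panel[OF s bCh j] tw by auto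
    have tCh: "twist \<sigma> c \<in> Ch" using in_pan panel_chamber by blast
    have "h s c \<noteq> 1" using color_one_iff[OF s c] sd by simp
    then have "?j \<noteq> 1" using one[OF c s] permutes_inj[OF perm[OF c s]] by (metis injD)
    \<comment> \<open>As \<open>\<sigma> c s\<close> is injective and fixes \<open>1\<close>, the image is above the chamber of colour \<open>1\<close> on its panel.\<close>
    then have sd': "s \<in> descents (twist \<sigma> c)" using color_one_iff[OF s tCh] hs by simp
    have colors: "h r (twist \<sigma> c) = \<sigma> c r (h r c)" if r: "r \<in> S" for r
    proof (cases "r = s")
      case True
      then show ?thesis using hs by simp
    next
      case rs: False
      show ?thesis
      proof (cases "r \<otimes> s = s \<otimes> r")
        case True
        have "h r (twist \<sigma> c) = h r (twist \<sigma> ?b)"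
          using color_commuting[OF r s rs True bCh in_pan] .
        also have "\<dots> = \<sigma> ?b r (h r ?b)" using IHb(2)[OF _ r] b(4) by simp
        also have "h r ?b = h r c" using color_commuting[OF r s rs True b(1,2)] by simp
        also have "\<sigma> ?b r = \<sigma> c r" using wall_invariantD[OF inv r s True b(1,2)] by simp
        finally show ?thesis .
      next
        case False
        then have "r \<notin> descents c" "r \<notin> descents (twist \<sigma> c)"
          using descents_commuting[OF c sd] descents_commuting[OF tCh sd'] by force+
        then have "h r c = 1" "h r (twist \<sigma> c) = 1"
          using color_one_iff[OF r c] color_one_iff[OF r tCh] by auto
        then show ?thesis using one[OF c r] by simp
      qed
    qed
    have pans: "twist \<sigma> c \<in> pan t (twist \<sigma> (down t c))" if td: "t \<in> descents c" for t
    proof (cases "t = s")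
      case True
      then show ?thesis using in_pan by simp
    next
      case ts: False
      have t: "t \<in> S" using td descents_gen by blast
      have comm: "s \<otimes> t = t \<otimes> s" using descents_commuting[OF c sd td] .
      note d = down[OF c td]
      let ?d = "down t c" let ?u = "down t ?b"
      have u_eq: "?u = down s ?d"
        using nbr_commute[OF t s ts comm[symmetric] c one_color[OF t] one_color[OF s]] .
      have tb: "t \<in> descents ?b" using down_descents_commuting[OF c sd t _ comm] ts td by simp
      have sd2: "s \<in> descents ?d" using down_descents_commuting[OF c td s ts comm[symmetric]] sd by simp
      have uCh: "?u \<in> Ch" using down(1)[OF b(1) tb] .
      have "depth ?u < depth c" using down(4)[OF b(1) tb] b(4) by simp
      then have tuCh: "twist \<sigma> ?u \<in> Ch" using IH(1) uCh by simp
      have p1: "twist \<sigma> ?b \<in> pan t (twist \<sigma> ?u)" using IHb(3)[OF _ tb] b(4) by simp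
      have p2: "twist \<sigma> ?d \<in> pan s (twist \<sigma> ?u)" using IH(3)[OF d(1) _ sd2] d(4) u_eq by simp
      have dCh: "twist \<sigma> ?d \<in> Ch" using IH(1)[OF d(1)] d(4) by simp
      have "h s (twist \<sigma> ?d) = \<sigma> ?d s (h s ?d)" using IH(2)[OF d(1) _ s] d(4) by simp
      also have "\<sigma> ?d s = \<sigma> c s" using wall_invariantD[OF inv s t comm d(1,2)] by simp
      also have "h s ?d = h s c" using color_commuting[OF s t ts[symmetric] comm d(1,2)] by simp
      finally have e1: "nbr s ?j (twist \<sigma> ?u) = twist \<sigma> ?d" using nbr_eqI[OF s tuCh p2] by simp
      let ?i = "h t (twist \<sigma> ?b)"
      have e2: "nbr t ?i (twist \<sigma> ?u) = twist \<sigma> ?b" using nbr_eqI[OF t tuCh p1] by simp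
      have i: "?i \<in> {1..q t}" using cr t bCh by simp
      have "twist \<sigma> c = nbr t ?i (twist \<sigma> ?d)"
        using nbr_commute[OF s t ts[symmetric] comm tuCh j i] e1 e2 tw by simp
      then show ?thesis using nbr_panel(1)[OF t dCh i] by simp
    qed
    show ?thesis using tCh colors pans by blast
  qed
qed

text \<open>
  Surjectivity follows from local finiteness: \<open>g\<close> maps each panel injectively into a panel with the
  same finite number of chambers, so its image is closed under adjacency.
\<close>

lemma based_aut_if_adjacency_preserved:
  assumes ext: "g \<in> extensional Ch" and g: "\<And>c. c \<in> Ch \<Longrightarrow> g c \<in> Ch"
    and adj: "\<And>c d s. c \<in> Ch \<Longrightarrow> d \<in> Ch \<Longrightarrow> s \<in> S \<Longrightarrow> \<delta> c d = s \<Longrightarrow> \<delta> (g c) (g d) = s"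
    and base_fixed: "g c0 = c0"
  shows "based_aut g"
proof -
  have dist: "\<delta> (g c) (g d) = \<delta> c d" if "c \<in> Ch" "d \<in> Ch" for c d
    using dist_preserved_if_adjacency_preserved[of g, OF g adj that] .
  have inj: "inj_on g Ch"
  proof (rule inj_onI)
    fix c d assume "c \<in> Ch" "d \<in> Ch" "g c = g d"
    then show "c = d" using dist[of c d] WD1[of "g c" "g d"] WD1[of c d] g by auto
  qed
  have onto: "d \<in> g ` Ch" if "d \<in> Ch" for d
    using that
  proof (induction "depth d" arbitrary: d rule: less_induct)
    case less
    show ?case
    proof (cases "d = c0")
      case True
      then show ?thesis using base_fixed base by (metis imageI)
    next
      case False
      then obtain s where sd: "s \<in> descents d" using exists_descent less.prems by blast
      then have s: "s \<in> S" using descents_gen by blast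
      note b = down[OF less.prems sd]
      obtain c where c: "c \<in> Ch" "down s d = g c" using less.hyps[OF _ b(1)] b(4) by auto
      have sub: "g ` pan s c \<subseteq> pan s (g c)" using adj[OF c(1) _ s] g by (auto simp: panel_def)
      have card: "card (pan s c) = q s" "card (pan s (g c)) = q s"
        using panel_card[OF s] c(1) g by (auto simp: panels_def)
      then have "card (pan s (g c)) > 0" using thick[OF s] by simp
      then have "finite (pan s (g c))" by (rule card_ge_0_finite)
      moreover have "card (g ` pan s c) = q s"
        using card(1) card_image[OF inj_on_subset[OF inj]] panel_chamber by (metis subsetI)
      ultimately have "g ` pan s c = pan s (g c)" using sub card(2) card_subset_eq by metis
      then have "d \<in> g ` pan s c" using b(2) c(2) by simp
      then show ?thesis using panel_chamber by blast
    qed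
  qed
  have "g ` Ch = Ch" using onto g by auto
  then show ?thesis
    using ext inj dist base_fixed by (simp add: based_aut_def building_auts_def Bij_def bij_betw_def)
qed

text \<open>
  Two adjacent chambers share the chamber below them on their panel, so their images lie on a common
  panel, with different colours.
\<close>

theorem aut_of_wall_invariant:
  assumes inv: "wall_invariant \<sigma>"
    and perm: "\<And>c s. c \<in> Ch \<Longrightarrow> s \<in> S \<Longrightarrow> \<sigma> c s permutes {1..q s}"
    and one: "\<And>c s. c \<in> Ch \<Longrightarrow> s \<in> S \<Longrightarrow> \<sigma> c s 1 = 1"
  obtains g where "based_aut g" "\<And>c s. c \<in> Ch \<Longrightarrow> s \<in> S \<Longrightarrow> lact s c g = \<sigma> c s"
proof -
  define g where "g = restrict (twist \<sigma>) Ch"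
  note tw = twist_properties[of \<sigma>, OF inv perm one]
  have g: "g c \<in> Ch" "\<And>s. s \<in> S \<Longrightarrow> h s (g c) = \<sigma> c s (h s c)"
    "\<And>s. s \<in> descents c \<Longrightarrow> g c \<in> pan s (g (down s c))" if "c \<in> Ch" for c
    using tw[OF _ _ _ _ that] down(1)[OF that] that by (simp_all add: g_def)
  have bottom: "g c \<in> pan s (g (down s c))" if c: "c \<in> Ch" and s: "s \<in> S" for c s
  proof (cases "s \<in> descents c")
    case False
    then have "down s c = c" using nbr_eqI[OF s c panel_refl[OF c]] color_one_iff[OF s c] by simp
    then show ?thesis using g(1)[OF c] by simp
  qed (use g c in blast)
  have pan: "g d \<in> pan s (g c)" if c: "c \<in> Ch" and s: "s \<in> S" and d: "d \<in> pan s c" for c d s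
  proof -
    have dCh: "d \<in> Ch" using d panel_chamber by blast
    have bCh: "down s c \<in> Ch" using nbr_chamber[OF s c one_color[OF s]] .
    have "g d \<in> pan s (g (down s c))"
      using bottom[OF dCh s] nbr_cong[OF s c d] by simp
    then show ?thesis
      using panel_trans[OF g(1)[OF c] s panel_sym[OF g(1)[OF bCh] s bottom[OF c s]]] by simp
  qed
  have adj: "\<delta> (g c) (g d) = s" if cd: "c \<in> Ch" "d \<in> Ch" "s \<in> S" "\<delta> c d = s" for c d s
  proof -
    have d: "d \<in> pan s c" and ne: "d \<noteq> c" using adjacent_iff_panel[of c s d] cd by auto
    have "h s c \<noteq> h s d" using panel_color_eq[OF cd(3,1) d panel_refl[OF cd(1)]] ne by auto
    then have "\<sigma> c s (h s c) \<noteq> \<sigma> c s (h s d)"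
      using permutes_inj[OF perm[OF cd(1,3)]] by (metis injD)
    also have "\<sigma> c s = \<sigma> d s" using wall_invariantD[OF inv cd(3,3) HOL.refl cd(1) d] by simp
    finally have "g c \<noteq> g d"
      using g(2) cd wall_invariantD[OF inv cd(3,3) HOL.refl cd(1) d] by metis
    then show ?thesis
      using adjacent_iff_panel[of "g c" s "g d"] pan[OF cd(1,3) d] g(1) cd by metis
  qed
  have ext: "g \<in> extensional Ch" and g0: "g c0 = c0" by (simp_all add: g_def twist.simps)
  have "based_aut g" by (rule based_aut_if_adjacency_preserved[OF ext g(1) adj g0])
  moreover have "lact s c g = \<sigma> c s" if c: "c \<in> Ch" and s: "s \<in> S" for c s
  proof
    fix i
    show "lact s c g i = \<sigma> c s i"
    proof (cases "i \<in> {1..q s}")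
      case True
      then have n: "nbr s i c \<in> pan s c" "h s (nbr s i c) = i" "nbr s i c \<in> Ch"
        using nbr_panel[OF s c] nbr_chamber[OF s c] by auto
      then have "h s (g (nbr s i c)) = \<sigma> c s i"
        using g(2)[OF n(3) s] wall_invariantD[OF inv s s HOL.refl c n(1)] by simp
      then show ?thesis using lact_apply[OF True] by simp
    next
      case False
      then show ?thesis using lact_outside perm[OF c s] permutes_not_in by metis
    qed
  qed
  ultimately show thesis by (rule that)
qed

section \<open>The panel of a tree-wall closest to the base chamber\<close>

text \<open>
  Walking down from \<open>c\<close> inside its \<open>s\<close>-tree-wall as far as possible.  The chamber reached does
  not depend on the path, by the diamond argument in \<open>root_down\<close>: two possible steps commute, hence
  lead to chambers with a common chamber below them.
\<close>

function root :: "'w \<Rightarrow> 'c \<Rightarrow> 'c" where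
  "root s c = (if c \<in> Ch \<and> (\<exists>t \<in> descents c. s \<otimes> t = t \<otimes> s)
     then root s (down (SOME t. t \<in> descents c \<and> s \<otimes> t = t \<otimes> s) c) else c)"
  by pat_completeness auto
termination
proof (relation "measure (depth \<circ> snd)")
  fix s c
  assume c: "c \<in> Ch \<and> (\<exists>t \<in> descents c. s \<otimes> t = t \<otimes> s)"
  then have "(SOME t. t \<in> descents c \<and> s \<otimes> t = t \<otimes> s) \<in> descents c" by (metis (mono_tags, lifting) someI)
  then show "((s, down (SOME t. t \<in> descents c \<and> s \<otimes> t = t \<otimes> s) c), s, c) \<in> measure (depth \<circ> snd)"
    using down(4) c by simp
qed simp

declare root.simps [simp del]

lemma root_step:
  assumes "c \<in> Ch" "t \<in> descents c" "s \<otimes> t = t \<otimes> s"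
  obtains u where "u \<in> descents c" "s \<otimes> u = u \<otimes> s" "root s c = root s (down u c)"
proof -
  let ?u = "SOME t. t \<in> descents c \<and> s \<otimes> t = t \<otimes> s"
  have "?u \<in> descents c \<and> s \<otimes> ?u = ?u \<otimes> s" using assms by (metis (mono_tags, lifting) someI)
  moreover have "root s c = root s (down ?u c)" using root.simps[of s c] assms by auto
  ultimately show thesis using that by blast
qed

lemma root_fixed: "(\<And>t. t \<in> descents c \<Longrightarrow> s \<otimes> t \<noteq> t \<otimes> s) \<Longrightarrow> root s c = c"
  by (subst root.simps) auto

lemma root_down:
  assumes "c \<in> Ch" "t \<in> descents c" "s \<otimes> t = t \<otimes> s"
  shows "root s (down t c) = root s c"
  using assms
proof (induction "depth c" arbitrary: c t rule: less_induct)
  case less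
  note c = less.prems(1) and td = less.prems(2)
  obtain u where ud: "u \<in> descents c" and su: "s \<otimes> u = u \<otimes> s" and r: "root s c = root s (down u c)"
    using root_step less.prems by metis
  show ?case
  proof (cases "t = u")
    case False
    have t: "t \<in> S" and u: "u \<in> S" using td ud descents_gen by auto
    have comm: "u \<otimes> t = t \<otimes> u" using descents_commuting[OF c ud td] .
    note dt = down[OF c td] and du = down[OF c ud]
    have tu: "t \<in> descents (down u c)"
      using down_descents_commuting[OF c ud t _ comm] False td by simp
    have ut: "u \<in> descents (down t c)"
      using down_descents_commuting[OF c td u False comm[symmetric]] ud by simp
    have "root s c = root s (down t (down u c))"
      using r less.hyps[OF _ du(1) tu less.prems(3)] du(4) by simp
    also have "down t (down u c) = down u (down t c)"
      using nbr_commute[OF t u False comm[symmetric] c one_color[OF t] one_color[OF u]] .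
    also have "root s \<dots> = root s (down t c)"
      using less.hyps[OF _ dt(1) ut su] dt(4) by simp
    finally show ?thesis by simp
  qed (use r in simp)
qed

text \<open>Chambers on one panel have the same chamber below them, and \<open>root_down\<close> applies to both.\<close>

lemma wall_invariant_root: "wall_invariant (\<lambda>c s. root s c)"
  unfolding wall_invariant_def
proof (intro ballI impI)
  fix s t c d
  assume st: "s \<in> S" "t \<in> S" "s \<otimes> t = t \<otimes> s" and c: "c \<in> Ch" and d: "d \<in> pan t c"
  have *: "root s (down t x) = root s x" if x: "x \<in> Ch" for x
  proof (cases "t \<in> descents x")
    case False
    then have "down t x = x" using nbr_eqI[OF st(2) x panel_refl[OF x]] color_one_iff[OF st(2) x] by simp
    then show ?thesis by simp
  qed (use root_down st x in blast)
  show "root s d = root s c"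
    using *[OF c] *[of d] nbr_cong[OF st(2) c d] panel_chamber[OF d] by simp
qed

lemma root_properties:
  assumes "c \<in> Ch"
  shows "root s c \<in> Ch \<and> depth (root s c) \<le> depth c \<and>
    (\<forall>t \<in> descents (root s c). s \<otimes> t \<noteq> t \<otimes> s)"
  using assms
proof (induction "depth c" arbitrary: c rule: less_induct)
  case less
  show ?case
  proof (cases "\<exists>t \<in> descents c. s \<otimes> t = t \<otimes> s")
    case True
    then obtain t where t: "t \<in> descents c" "s \<otimes> t = t \<otimes> s" by blast
    note d = down[OF less.prems t(1)]
    show ?thesis using root_down[OF less.prems t] less.hyps[OF _ d(1)] d(4) by auto
  next
    case False
    then show ?thesis using root_fixed[of c s] less.prems by auto
  qed
qed

text \<open>
  So \<open>Z\<^sub>n\<close> consists of the possible values of \<open>root\<close> at depth \<open>n\<close>.  Let \<open>w = \<delta> c0 c\<close>.  A descent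
  \<open>t\<close> of \<open>w\<close> commuting with \<open>s\<close> would persist in \<open>w s\<close> and be a second descent there; conversely, a
  second descent of \<open>w s\<close> commutes with the descent \<open>s\<close> and hence is already one of \<open>w\<close>.
\<close>

lemma Z_set_iff:
  "(c, s) \<in> Z_set W S Ch \<delta> c0 n \<longleftrightarrow>
    c \<in> Ch \<and> depth c = n \<and> s \<in> S \<and> (\<forall>t \<in> descents c. s \<otimes> t \<noteq> t \<otimes> s)"
proof -
  have "\<delta> c0 c \<otimes> s \<in> W1 W S (n + 1) \<longleftrightarrow> (\<forall>t \<in> descents c. s \<otimes> t \<noteq> t \<otimes> s)"
    if c: "c \<in> Ch" "depth c = n" and s: "s \<in> S"
  proof -
    let ?w = "\<delta> c0 c"
    have w: "?w \<in> carrier W" "len ?w = n" using c by (auto simp: depth_def)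
    show ?thesis
    proof
      assume "?w \<otimes> s \<in> W1 W S (n + 1)"
      then have len: "len (?w \<otimes> s) = n + 1" and card: "card (right_descents W S (?w \<otimes> s)) = 1"
        by (auto simp: W1_def)
      have nd: "s \<notin> descents c" using len w by (auto simp: descents_def right_descents_def)
      then have "s \<in> right_descents W S (?w \<otimes> s)"
        using descent_mult_self[OF w(1) s] by (simp add: descents_def)
      then have single: "right_descents W S (?w \<otimes> s) = {s}" using card by (auto simp: card_1_singleton_iff)
      show "\<forall>t \<in> descents c. s \<otimes> t \<noteq> t \<otimes> s"
      proof (intro ballI notI)
        fix t assume t: "t \<in> descents c" "s \<otimes> t = t \<otimes> s"
        then have "t \<noteq> s" using nd by auto
        then have "t \<in> right_descents W S (?w \<otimes> s)"
          using descent_mult_commuting[OF w(1) descents_gen[OF t(1)] s] t by (simp add: descents_def)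
        then show False using single \<open>t \<noteq> s\<close> by simp
      qed
    next
      assume nc: "\<forall>t \<in> descents c. s \<otimes> t \<noteq> t \<otimes> s"
      then have nd: "s \<notin> right_descents W S ?w" by (auto simp: descents_def)
      have sd: "s \<in> right_descents W S (?w \<otimes> s)" using descent_mult_self[OF w(1) s] nd by simp
      have ws: "?w \<otimes> s \<in> carrier W" using w s by simp
      have "t = s" if t: "t \<in> right_descents W S (?w \<otimes> s)" for t
      proof (rule ccontr)
        assume "t \<noteq> s"
        have comm: "s \<otimes> t = t \<otimes> s" using descents_commute[OF ws sd t] .
        have "t \<in> S" using t by (simp add: right_descents_def)
        then have "t \<in> descents c"
          using descent_mult_commuting[OF w(1) _ s \<open>t \<noteq> s\<close>] comm t by (simp add: descents_def)
        then show False using nc comm by blast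
      qed
      then have "right_descents W S (?w \<otimes> s) = {s}" using sd by blast
      then show "?w \<otimes> s \<in> W1 W S (n + 1)"
        using len_no_descent[OF w(1) s nd] w ws by (simp add: W1_def)
    qed
  qed
  then show ?thesis by (auto simp: Z_set_def A_sphere_def depth_def)
qed

end

section \<open>The restrictions of the stabilizer to balls\<close>

lemma iso_if_same_fibres:
  assumes closed: "\<And>x y. x \<in> carrier A \<Longrightarrow> y \<in> carrier A \<Longrightarrow> x \<otimes>\<^bsub>A\<^esub> y \<in> carrier A"
    and f1: "f1 \<in> hom A H1" "f1 ` carrier A = carrier H1"
    and f2: "f2 \<in> hom A H2" "f2 ` carrier A = carrier H2"
    and fibres: "\<And>x y. x \<in> carrier A \<Longrightarrow> y \<in> carrier A \<Longrightarrow> f1 x = f1 y \<longleftrightarrow> f2 x = f2 y"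
  shows "H1 \<cong> H2"
proof -
  define \<theta> where "\<theta> a = f2 (inv_into (carrier A) f1 a)" for a
  have \<theta>: "\<theta> (f1 x) = f2 x" if "x \<in> carrier A" for x
  proof -
    have "f1 x \<in> f1 ` carrier A" using that by simp
    then have "inv_into (carrier A) f1 (f1 x) \<in> carrier A" "f1 (inv_into (carrier A) f1 (f1 x)) = f1 x"
      by (rule inv_into_into, rule f_inv_into_f)
    then show ?thesis using fibres that by (simp add: \<theta>_def)
  qed
  have "\<theta> \<in> hom H1 H2"
  proof (rule homI)
    fix a assume "a \<in> carrier H1"
    then obtain x where "x \<in> carrier A" "a = f1 x" using f1(2) by auto
    then show "\<theta> a \<in> carrier H2" using \<theta> f2(2) by auto
  next
    fix a b assume "a \<in> carrier H1" "b \<in> carrier H1"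
    then obtain x y where xy: "x \<in> carrier A" "y \<in> carrier A" and ab: "a = f1 x" "b = f1 y"
      unfolding f1(2)[symmetric] by blast
    have "a \<otimes>\<^bsub>H1\<^esub> b = f1 (x \<otimes>\<^bsub>A\<^esub> y)" using hom_mult[OF f1(1) xy] ab by simp
    then show "\<theta> (a \<otimes>\<^bsub>H1\<^esub> b) = \<theta> a \<otimes>\<^bsub>H2\<^esub> \<theta> b"
      using hom_mult[OF f2(1) xy] \<theta>[OF closed[OF xy]] \<theta>[OF xy(1)] \<theta>[OF xy(2)] ab by simp
  qed
  moreover have "bij_betw \<theta> (carrier H1) (carrier H2)"
  proof (rule bij_betw_imageI)
    show "inj_on \<theta> (carrier H1)"
    proof (rule inj_onI)
      fix a b assume "a \<in> carrier H1" "b \<in> carrier H1" and eq: "\<theta> a = \<theta> b"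
      then obtain x y where xy: "x \<in> carrier A" "y \<in> carrier A" "a = f1 x" "b = f1 y"
        unfolding f1(2)[symmetric] by blast
      then show "a = b" using eq \<theta>[OF xy(1)] \<theta>[OF xy(2)] fibres[OF xy(1,2)] by simp
    qed
    have "\<theta> ` f1 ` carrier A = f2 ` carrier A"
      unfolding image_image by (rule image_cong) (simp_all add: \<theta>)
    then show "\<theta> ` carrier H1 = carrier H2" using f1(2) f2(2) by simp
  qed
  ultimately show ?thesis by (auto simp: is_iso_def iso_def)
qed

locale universal_group_setting = colored_building W S Ch \<delta> q c0 h
  for W :: "('w, 'm) monoid_scheme" (structure) and S :: "'w set"
    and Ch :: "'c set" and \<delta> :: "'c \<Rightarrow> 'c \<Rightarrow> 'w" and q :: "'w \<Rightarrow> nat"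
    and c0 :: 'c and h :: "'w \<Rightarrow> 'c \<Rightarrow> nat" +
  fixes G :: "'w \<Rightarrow> (nat \<Rightarrow> nat) set"
  assumes local_group: "s \<in> S \<Longrightarrow> transitive_perm_group (q s) (G s)"
begin

abbreviation U0 :: "('c \<Rightarrow> 'c) monoid" where
  "U0 \<equiv> chamber_stabilizer Ch (universal_group S Ch \<delta> q h G) c0"
abbreviation B :: "nat \<Rightarrow> 'c set" where "B \<equiv> chamber_ball W S Ch \<delta> c0"
abbreviation K :: "nat \<Rightarrow> ('c \<Rightarrow> 'c) monoid" where "K n \<equiv> induced_perm_group U0 (B n)"
abbreviation Z :: "nat \<Rightarrow> ('c \<times> 'w) set" where "Z \<equiv> Z_set W S Ch \<delta> c0"
abbreviation N :: "nat \<Rightarrow> ('c \<times> 'w \<Rightarrow> nat \<Rightarrow> nat) monoid" where "N n \<equiv> Z_product (Z n) q G"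
abbreviation \<phi> :: "nat \<Rightarrow> ('c \<Rightarrow> 'c) \<Rightarrow> ('c \<times> 'w \<Rightarrow> nat \<Rightarrow> nat) \<Rightarrow> ('c \<times> 'w \<Rightarrow> nat \<Rightarrow> nat)"
  where "\<phi> n \<equiv> permute_entries (B n) (Z n) (N n)"
abbreviation iv :: "('c \<Rightarrow> 'c) \<Rightarrow> 'c \<Rightarrow> 'c" where "iv \<equiv> inv_into Ch"

lemma local_subgroup: "s \<in> S \<Longrightarrow> subgroup (G s) (sym_group (q s))"
  using local_group by (simp add: transitive_perm_group_def)

lemma local_permutes: "s \<in> S \<Longrightarrow> p \<in> G s \<Longrightarrow> p permutes {1..q s}"
  using subgroup.subset[OF local_subgroup] by (auto simp: sym_group_def)

lemma local_comp: "s \<in> S \<Longrightarrow> p \<in> G s \<Longrightarrow> p' \<in> G s \<Longrightarrow> p \<circ> p' \<in> G s"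
  using subgroup.m_closed[OF local_subgroup] by (simp add: sym_group_def)

lemma U0_iff:
  "g \<in> carrier U0 \<longleftrightarrow> based_aut g \<and> (\<forall>s \<in> S. \<forall>c \<in> Ch. lact s c g \<in> G s)"
  by (auto simp: chamber_stabilizer_def universal_group_def based_aut_def)

lemma U0_aut: "g \<in> carrier U0 \<Longrightarrow> based_aut g"
  by (simp add: U0_iff)

lemma U0_Bij: "g \<in> carrier U0 \<Longrightarrow> g \<in> Bij Ch"
  using U0_aut by (simp add: based_aut_def building_auts_def)

lemma U0_mult: "g \<in> carrier U0 \<Longrightarrow> g' \<in> carrier U0 \<Longrightarrow> g \<otimes>\<^bsub>U0\<^esub> g' = compose Ch g g'"
  using U0_Bij[of g] U0_Bij[of g'] by (simp add: chamber_stabilizer_def BijGroup_def)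

lemma aut_compose:
  assumes "based_aut g" "based_aut g'"
  shows "based_aut (compose Ch g g')"
  using assms compose_Bij[of g Ch g'] aut_chamber[OF assms(2)]
  by (auto simp: based_aut_def building_auts_def compose_eq)

text \<open>
  The chain rule: \<open>g'\<close> moves the panel at \<open>c\<close> to the one at \<open>g' c\<close>, where \<open>g\<close> acts next.
\<close>

lemma lact_compose:
  assumes g: "based_aut g" "based_aut g'" and s: "s \<in> S" and c: "c \<in> Ch"
  shows "lact s c (compose Ch g g') = lact s (g' c) g \<circ> lact s c g'"
proof
  fix i
  show "lact s c (compose Ch g g') i = (lact s (g' c) g \<circ> lact s c g') i"
  proof (cases "i \<in> {1..q s}")
    case True
    have n: "nbr s i c \<in> Ch" using nbr_chamber[OF s c True] .
    have r: "lact s c g' i \<in> {1..q s}"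
      using lact_apply[OF True] color_range[OF s aut_chamber[OF g(2) n]] by simp
    show ?thesis
      using lact_apply[OF True, of c "compose Ch g g'"] lact_apply[OF r, of "g' c" g]
        aut_nbr[OF g(2) s c True] n by (simp add: compose_eq)
  qed (simp only: o_apply lact_outside not_False_eq_True)
qed

lemma U0_closed:
  assumes "g \<in> carrier U0" "g' \<in> carrier U0"
  shows "compose Ch g g' \<in> carrier U0"
proof -
  have a: "based_aut g" "based_aut g'" using assms U0_aut by auto
  have "lact s c (compose Ch g g') \<in> G s" if s: "s \<in> S" and c: "c \<in> Ch" for s c
    using lact_compose[OF a s c] local_comp[OF s] assms s c aut_chamber[OF a(2) c]
    by (simp add: U0_iff)
  then show ?thesis using aut_compose[OF a] by (simp add: U0_iff)
qed

lemma ball_iff: "c \<in> B n \<longleftrightarrow> c \<in> Ch \<and> depth c \<le> n"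
  by (simp add: chamber_ball_def depth_def)

lemma iv_simps:
  assumes "based_aut g" "c \<in> Ch"
  shows "iv g c \<in> Ch" "g (iv g c) = c" "iv g (g c) = c"
  using aut_bij[OF assms(1)] assms(2)
  by (auto simp: bij_betw_def inv_into_into f_inv_into_f)

lemma iv_eqI: "based_aut g \<Longrightarrow> x \<in> Ch \<Longrightarrow> g x = c \<Longrightarrow> iv g c = x"
  using iv_simps(3) by blast

lemma iv_depth: "based_aut g \<Longrightarrow> c \<in> Ch \<Longrightarrow> depth (iv g c) = depth c"
  using aut_depth[of g "iv g c"] iv_simps[of g c] by simp

lemma iv_compose:
  assumes "based_aut g" "based_aut g'" "c \<in> Ch"
  shows "iv (compose Ch g g') c = iv g' (iv g c)"
  using iv_simps[OF assms(2), of "iv g c"] iv_simps[OF assms(1,3)]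
  by (intro iv_eqI aut_compose assms) (auto simp: compose_eq)

lemma restrict_Bij_ball:
  assumes g: "based_aut g"
  shows "restrict g (B n) \<in> Bij (B n)"
proof -
  have "inj_on g (B n)" using aut_bij[OF g] by (auto simp: bij_betw_def ball_iff inj_on_def)
  moreover have "g ` B n = B n"
  proof
    show "g ` B n \<subseteq> B n" using aut_chamber[OF g] aut_depth[OF g] by (auto simp: ball_iff)
    show "B n \<subseteq> g ` B n"
    proof
      fix c assume c: "c \<in> B n"
      then have "iv g c \<in> B n" using iv_simps(1)[OF g] iv_depth[OF g] by (auto simp: ball_iff)
      moreover have "c = g (iv g c)" using iv_simps(2)[OF g, of c] c by (simp add: ball_iff)
      ultimately show "c \<in> g ` B n" by (rule rev_image_eqI)
    qed
  qed
  ultimately show ?thesis by (simp add: Bij_def bij_betw_def)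
qed

lemma inv_restrict_ball:
  assumes g: "based_aut g" and c: "c \<in> B n"
  shows "inv_into (B n) (restrict g (B n)) c = iv g c"
proof (rule inv_into_f_eq)
  show "inj_on (restrict g (B n)) (B n)" using restrict_Bij_ball[OF g] by (simp add: Bij_def bij_betw_def)
  show "iv g c \<in> B n" using c iv_simps(1)[OF g] iv_depth[OF g] by (auto simp: ball_iff)
  then show "restrict g (B n) (iv g c) = c" using iv_simps(2)[OF g] c by (simp add: ball_iff)
qed

lemma K_carrier: "carrier (K n) = (\<lambda>g. restrict g (B n)) ` carrier U0"
  by (simp add: induced_perm_group_def)

text \<open>Elements of the stabilizer preserve balls, so composing commutes with restricting.\<close>

lemma K_mult:
  assumes "g \<in> carrier U0" "g' \<in> carrier U0"
  shows "restrict g (B n) \<otimes>\<^bsub>K n\<^esub> restrict g' (B n) = restrict (compose Ch g g') (B n)"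
proof -
  have g: "based_aut g" "based_aut g'" using assms U0_aut by auto
  have "restrict g (B n) \<otimes>\<^bsub>K n\<^esub> restrict g' (B n) = compose (B n) (restrict g (B n)) (restrict g' (B n))"
    using restrict_Bij_ball g by (simp add: induced_perm_group_def BijGroup_def)
  also have "\<dots> = restrict (compose Ch g g') (B n)"
    using aut_chamber[OF g(2)] aut_depth[OF g(2)] by (auto simp: compose_def restrict_def fun_eq_iff ball_iff)
  finally show ?thesis .
qed

lemma restrict_hom: "(\<lambda>g. restrict g (B n)) \<in> hom U0 (K n)"
  by (rule homI) (auto simp: K_carrier U0_mult K_mult)

lemma Z_aut:
  assumes "based_aut g" "c \<in> Ch"
  shows "(g c, s) \<in> Z n \<longleftrightarrow> (c, s) \<in> Z n"
  using assms by (simp add: Z_set_iff aut_chamber aut_depth aut_descents)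

lemma Z_chamber: "(c, s) \<in> Z n \<Longrightarrow> c \<in> Ch"
  by (simp add: Z_set_iff)

lemma Z_iv:
  assumes "based_aut g" "(c, s) \<in> Z n"
  shows "(iv g c, s) \<in> Z n"
proof -
  have "c \<in> Ch" using assms by (simp add: Z_set_iff)
  then show ?thesis using Z_aut[OF assms(1), of "iv g c"] iv_simps[OF assms(1), of c] assms(2) by simp
qed

lemma Z_ball: "(c, s) \<in> Z n \<Longrightarrow> c \<in> B n"
  by (simp add: Z_set_iff ball_iff)

lemma panel_depth_le:
  assumes "s \<in> S" "c \<in> Ch" "d \<in> pan s c"
  shows "depth d \<le> depth c + 1"
proof (cases "d = c")
  case False
  then have "d \<in> Ch" "\<delta> c d = s" using assms by (auto simp: panel_def)
  then show ?thesis
    using dist_right(1)[of c0 c d s] len_mult_gen_le[of "\<delta> c0 c" s] assms by (auto simp: depth_def)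
qed simp

text \<open>
  A chamber of the ball of radius \<open>n\<close> adjacent to one at distance \<open>n + 1\<close> is itself at distance
  \<open>n\<close>, and the type of the adjacency is the index \<open>s\<close>.
\<close>

lemma fst_Z_eq_C: "fst ` Z n = C_set W S Ch \<delta> c0 n"
proof
  show "fst ` Z n \<subseteq> C_set W S Ch \<delta> c0 n"
  proof
    fix c assume "c \<in> fst ` Z n"
    then obtain s where s: "(c, s) \<in> Z n" by auto
    then have c: "c \<in> Ch" "s \<in> S" "\<delta> c0 c \<otimes> s \<in> W1 W S (n + 1)"
      by (auto simp: Z_set_def A_sphere_def)
    obtain d where d: "d \<in> Ch" "\<delta> c d = s" "\<delta> c0 d = \<delta> c0 c \<otimes> s"
      using exists_adjacent[OF base c(1,2)] by blast
    then have "d \<in> A1_sphere W S Ch \<delta> c0 (n + 1)"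
      using c(3) by (auto simp: A1_sphere_def A_sphere_def W1_def)
    then show "c \<in> C_set W S Ch \<delta> c0 n"
      unfolding C_set_def using Z_ball[OF s] c(2) d(2) by blast
  qed
  show "C_set W S Ch \<delta> c0 n \<subseteq> fst ` Z n"
  proof
    fix c assume "c \<in> C_set W S Ch \<delta> c0 n"
    then obtain d where c: "c \<in> Ch" "depth c \<le> n" and s: "\<delta> c d \<in> S"
      and d: "d \<in> Ch" "depth d = n + 1" "\<delta> c0 d \<in> W1 W S (n + 1)"
      by (auto simp: C_set_def ball_iff A1_sphere_def A_sphere_def depth_def)
    have "depth d \<le> depth c + 1" using panel_depth_le[OF s c(1)] d(1) by (simp add: panel_def)
    then have n: "depth c = n" using c d by simp
    have "\<delta> c0 d \<noteq> \<delta> c0 c" using n d by (auto simp: depth_def)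
    then have "\<delta> c0 d = \<delta> c0 c \<otimes> \<delta> c d"
      using dist_right(1)[OF base c(1) d(1) s HOL.refl] by simp
    then have "(c, \<delta> c d) \<in> Z n" using n c s d by (simp add: Z_set_def A_sphere_def depth_def)
    then show "c \<in> fst ` Z n" by force
  qed
qed

lemma K_C_image:
  assumes "k \<in> carrier (K n)"
  shows "k ` C_set W S Ch \<delta> c0 n = C_set W S Ch \<delta> c0 n"
proof -
  obtain g where g: "based_aut g" and k: "k = restrict g (B n)" using assms U0_aut by (auto simp: K_carrier)
  have "k ` fst ` Z n = fst ` Z n"
  proof
    show "k ` fst ` Z n \<subseteq> fst ` Z n"
    proof clarify
      fix c s assume z: "(c, s) \<in> Z n"
      then have "(g c, s) \<in> Z n" using Z_aut[OF g Z_chamber[OF z]] by simp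
      then show "k (fst (c, s)) \<in> fst ` Z n" using k Z_ball[OF z] by force
    qed
    show "fst ` Z n \<subseteq> k ` fst ` Z n"
    proof clarify
      fix c s assume z: "(c, s) \<in> Z n"
      have z': "(iv g c, s) \<in> Z n" using Z_iv[OF g z] .
      have "k (iv g c) = c" using iv_simps(2)[OF g] Z_ball[OF z'] z k by (simp add: Z_set_iff)
      then show "fst (c, s) \<in> k ` fst ` Z n" using z' by force
    qed
  qed
  then show ?thesis by (simp add: fst_Z_eq_C)
qed

lemma N_carrier: "a \<in> carrier (N n) \<longleftrightarrow>
    a \<in> extensional (Z n) \<and> (\<forall>c s. (c, s) \<in> Z n \<longrightarrow> a (c, s) \<in> G s \<and> a (c, s) 1 = 1)"
  by (auto simp: Z_product_def PiE_iff stab_one_def)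

lemma N_mult: "a \<otimes>\<^bsub>N n\<^esub> b = (\<lambda>z \<in> Z n. a z \<circ> b z)"
  by (auto simp: Z_product_def stab_one_def sym_group_def fun_eq_iff restrict_def split: prod.splits)

lemma N_closed:
  assumes "a \<in> carrier (N n)" "b \<in> carrier (N n)"
  shows "a \<otimes>\<^bsub>N n\<^esub> b \<in> carrier (N n)"
  using assms local_comp by (auto simp: N_carrier N_mult Z_set_iff)

lemma \<phi>_apply:
  assumes "based_aut g" "a \<in> carrier (N n)"
  shows "\<phi> n (restrict g (B n)) a = (\<lambda>z \<in> Z n. a (iv g (fst z), snd z))"
  using assms Z_ball by (auto simp: permute_entries_def inv_restrict_ball intro!: restrict_ext)

lemma \<phi>_closed:
  assumes "based_aut g" "a \<in> carrier (N n)"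
  shows "\<phi> n (restrict g (B n)) a \<in> carrier (N n)"
  using assms Z_iv[OF assms(1)] by (simp add: \<phi>_apply) (simp add: N_carrier)

lemma \<phi>_compose:
  assumes g: "based_aut g" "based_aut g'" and a: "a \<in> carrier (N n)"
  shows "\<phi> n (restrict (compose Ch g g') (B n)) a =
    \<phi> n (restrict g (B n)) (\<phi> n (restrict g' (B n)) a)"
proof -
  have "(iv g c, s) \<in> Z n" "iv (compose Ch g g') c = iv g' (iv g c)" if "(c, s) \<in> Z n" for c s
    using Z_iv[OF g(1) that] iv_compose[OF g] that by (auto simp: Z_set_iff)
  then show ?thesis
    using \<phi>_apply[OF aut_compose[OF g] a] \<phi>_apply[OF g(1) \<phi>_closed[OF g(2) a]] \<phi>_apply[OF g(2) a]
    by (auto intro!: restrict_ext)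
qed

text \<open>The inverse of permuting the entries by \<open>g\<close> reads the entry at \<open>(g c, s)\<close> instead.\<close>

lemma \<phi>_auto:
  assumes g: "based_aut g"
  shows "\<phi> n (restrict g (B n)) \<in> auto (N n)"
proof -
  let ?f = "\<phi> n (restrict g (B n))"
  have "?f \<in> hom (N n) (N n)"
  proof (rule homI)
    fix a b assume ab: "a \<in> carrier (N n)" "b \<in> carrier (N n)"
    have "?f (a \<otimes>\<^bsub>N n\<^esub> b) = (\<lambda>z \<in> Z n. (a \<otimes>\<^bsub>N n\<^esub> b) (iv g (fst z), snd z))"
      using \<phi>_apply[OF g N_closed[OF ab]] .
    also have "\<dots> = (\<lambda>z \<in> Z n. ?f a z \<circ> ?f b z)"
      using Z_iv[OF g] by (auto intro!: restrict_ext simp: \<phi>_apply[OF g] ab N_mult)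
    finally show "?f (a \<otimes>\<^bsub>N n\<^esub> b) = ?f a \<otimes>\<^bsub>N n\<^esub> ?f b" by (simp add: N_mult)
  qed (rule \<phi>_closed[OF g])
  moreover have "bij_betw ?f (carrier (N n)) (carrier (N n))"
  proof (rule bij_betw_byWitness)
    let ?f' = "\<lambda>a. \<lambda>z \<in> Z n. a (g (fst z), snd z)"
    have gz: "(g c, s) \<in> Z n" if "(c, s) \<in> Z n" for c s
      using Z_aut[OF g Z_chamber[OF that]] that by simp
    have f': "?f' a \<in> carrier (N n)" if "a \<in> carrier (N n)" for a
      using that gz by (auto simp: N_carrier)
    show "?f' ` carrier (N n) \<subseteq> carrier (N n)" using f' by blast
    show "?f ` carrier (N n) \<subseteq> carrier (N n)" using \<phi>_closed[OF g] by blast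
    show "\<forall>a \<in> carrier (N n). ?f' (?f a) = a"
    proof
      fix a assume a: "a \<in> carrier (N n)"
      show "?f' (?f a) = a"
        using a gz iv_simps(3)[OF g] unfolding \<phi>_apply[OF g a]
        by (auto simp: N_carrier Z_set_iff intro!: extensionalityI[of _ "Z n"])
    qed
    show "\<forall>a \<in> carrier (N n). ?f (?f' a) = a"
    proof
      fix a assume a: "a \<in> carrier (N n)"
      show "?f (?f' a) = a"
        using a Z_iv[OF g] iv_simps(2)[OF g] unfolding \<phi>_apply[OF g f'[OF a]]
        by (auto simp: N_carrier intro!: extensionalityI[of _ "Z n"]) (simp add: Z_set_iff)
    qed
  qed
  moreover have "?f \<in> extensional (carrier (N n))" by (simp add: permute_entries_def)
  ultimately show ?thesis by (simp add: auto_def Bij_def)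
qed

lemma \<phi>_hom: "\<phi> n \<in> hom (K n) (AutoGroup (N n))"
proof (rule homI)
  fix k assume "k \<in> carrier (K n)"
  then show "\<phi> n k \<in> carrier (AutoGroup (N n))"
    using \<phi>_auto U0_aut by (auto simp: K_carrier AutoGroup_def)
next
  fix k l assume "k \<in> carrier (K n)" "l \<in> carrier (K n)"
  then obtain g g' where g: "g \<in> carrier U0" "g' \<in> carrier U0"
    and kl: "k = restrict g (B n)" "l = restrict g' (B n)" by (auto simp: K_carrier)
  have a: "based_aut g" "based_aut g'" using g U0_aut by auto
  have "\<phi> n k \<otimes>\<^bsub>AutoGroup (N n)\<^esub> \<phi> n l = compose (carrier (N n)) (\<phi> n k) (\<phi> n l)"
    using \<phi>_auto[OF a(1)] \<phi>_auto[OF a(2)] kl by (simp add: AutoGroup_def BijGroup_def auto_def)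
  also have "\<dots> = \<phi> n (restrict (compose Ch g g') (B n))"
  proof (rule extensionalityI)
    show "\<phi> n (restrict (compose Ch g g') (B n)) \<in> extensional (carrier (N n))"
      by (simp add: permute_entries_def)
    fix b assume "b \<in> carrier (N n)"
    then show "compose (carrier (N n)) (\<phi> n k) (\<phi> n l) b = \<phi> n (restrict (compose Ch g g') (B n)) b"
      using \<phi>_compose[OF a] kl by (simp add: compose_eq)
  qed (rule compose_extensional)
  finally show "\<phi> n (k \<otimes>\<^bsub>K n\<^esub> l) = \<phi> n k \<otimes>\<^bsub>AutoGroup (N n)\<^esub> \<phi> n l"
    using K_mult[OF g] kl by simp
qed

text \<open>
  The index \<open>(c, s)\<close> is attached to the target panel: the entry describes the action of \<open>g\<close> from the
  panel at \<open>g\<^sup>-\<^sup>1 c\<close> to the one at \<open>c\<close>.  This makes the chain rule agree with the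
  multiplication of the semidirect product, in which the normal factor is written on the left.
\<close>

definition new_actions :: "nat \<Rightarrow> ('c \<Rightarrow> 'c) \<Rightarrow> 'c \<times> 'w \<Rightarrow> nat \<Rightarrow> nat" where
  "new_actions n g = (\<lambda>(c, s) \<in> Z n. lact s (iv g c) g)"

definition split_ball :: "nat \<Rightarrow> ('c \<Rightarrow> 'c) \<Rightarrow> ('c \<times> 'w \<Rightarrow> nat \<Rightarrow> nat) \<times> ('c \<Rightarrow> 'c)" where
  "split_ball n g = (new_actions n g, restrict g (B n))"

lemma new_actions_apply: "(c, s) \<in> Z n \<Longrightarrow> new_actions n g (c, s) = lact s (iv g c) g"
  by (simp add: new_actions_def)

lemma new_actions_N:
  assumes "g \<in> carrier U0"
  shows "new_actions n g \<in> carrier (N n)"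
proof -
  have g: "based_aut g" using U0_aut assms .
  have "new_actions n g (c, s) \<in> G s \<and> new_actions n g (c, s) 1 = 1" if z: "(c, s) \<in> Z n" for c s
  proof -
    have "iv g c \<in> Ch" "s \<in> S" using iv_simps(1)[OF g] z by (auto simp: Z_set_iff)
    then show ?thesis using assms lact_one[OF g] z by (simp add: new_actions_apply U0_iff del: One_nat_def)
  qed
  then show ?thesis by (auto simp: N_carrier new_actions_def)
qed

lemma split_ball_hom: "split_ball n \<in> hom U0 (semidirect_product (N n) (K n) (\<phi> n))"
proof (rule homI)
  fix g assume "g \<in> carrier U0"
  then show "split_ball n g \<in> carrier (semidirect_product (N n) (K n) (\<phi> n))"
    using new_actions_N by (simp add: split_ball_def semidirect_product_def K_carrier)
next
  fix g g' assume U: "g \<in> carrier U0" "g' \<in> carrier U0"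
  have a: "based_aut g" "based_aut g'" using U U0_aut by auto
  have "new_actions n (compose Ch g g') =
    new_actions n g \<otimes>\<^bsub>N n\<^esub> \<phi> n (restrict g (B n)) (new_actions n g')"
    unfolding N_mult \<phi>_apply[OF a(1) new_actions_N[OF U(2)]]
  proof (rule extensionalityI)
    fix z assume "z \<in> Z n"
    then obtain c s where z: "z = (c, s)" "(c, s) \<in> Z n" by (cases z) auto
    have cs: "c \<in> Ch" "s \<in> S" using z by (auto simp: Z_set_iff)
    note iv = iv_simps[OF a(1) cs(1)] and iv' = iv_simps[OF a(2) iv_simps(1)[OF a(1) cs(1)]]
    have "new_actions n (compose Ch g g') (c, s) =
        lact s (iv g c) g \<circ> lact s (iv g' (iv g c)) g'"
      using new_actions_apply[OF z(2)] iv_compose[OF a cs(1)] lact_compose[OF a cs(2) iv'(1)] iv'(2)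
      by simp
    also have "\<dots> = new_actions n g (c, s) \<circ> new_actions n g' (iv g c, s)"
      using new_actions_apply[OF z(2)] new_actions_apply[OF Z_iv[OF a(1) z(2)]] by simp
    finally show "new_actions n (compose Ch g g') z = (\<lambda>z \<in> Z n. new_actions n g z \<circ>
        (\<lambda>z \<in> Z n. new_actions n g' (iv g (fst z), snd z)) z) z"
      using z by simp
  qed (auto simp: new_actions_def)
  then show "split_ball n (g \<otimes>\<^bsub>U0\<^esub> g') =
      split_ball n g \<otimes>\<^bsub>semidirect_product (N n) (K n) (\<phi> n)\<^esub> split_ball n g'"
    using U0_mult[OF U] K_mult[OF U] by (simp add: split_ball_def semidirect_product_def)
qed

text \<open>
  Given \<open>a\<close> in the product and the restriction of \<open>g0\<close>, the local actions of \<open>g0\<close> are replaced by the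
  entries of \<open>a\<close> on those tree-walls whose root is in \<open>Z\<^sub>n\<close>.  The automorphism with these
  local actions agrees with \<open>g0\<close> on the ball of radius \<open>n\<close>, because tree-walls that meet the interior
  of this ball have their root there.
\<close>

lemma split_ball_surj:
  "split_ball n ` carrier U0 = carrier (semidirect_product (N n) (K n) (\<phi> n))"
proof
  show "split_ball n ` carrier U0 \<subseteq> carrier (semidirect_product (N n) (K n) (\<phi> n))"
    using split_ball_hom[of n] by (auto simp: hom_def)
  show "carrier (semidirect_product (N n) (K n) (\<phi> n)) \<subseteq> split_ball n ` carrier U0"
  proof
    fix x assume "x \<in> carrier (semidirect_product (N n) (K n) (\<phi> n))"
    then obtain a g0 where a: "a \<in> carrier (N n)" and U: "g0 \<in> carrier U0"
      and x: "x = (a, restrict g0 (B n))"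
      by (auto simp: semidirect_product_def K_carrier)
    have g0: "based_aut g0" using U U0_aut by simp
    define \<sigma> where "\<sigma> c s =
      (if (root s c, s) \<in> Z n then a (g0 (root s c), s) else lact s c g0)" for c s
    have inv: "wall_invariant \<sigma>"
      unfolding wall_invariant_def
    proof (intro ballI impI)
      fix s t c d
      assume *: "s \<in> S" "t \<in> S" "c \<in> Ch" "d \<in> pan t c" "s \<otimes> t = t \<otimes> s"
      show "\<sigma> d s = \<sigma> c s"
        using wall_invariantD[OF wall_invariant_root *(1,2,5,3,4)]
          wall_invariantD[OF wall_invariant_lact[OF g0] *(1,2,5,3,4)]
        unfolding \<sigma>_def by (simp only:)
    qed
    have \<sigma>: "\<sigma> c s \<in> G s" "\<sigma> c s 1 = 1" if c: "c \<in> Ch" and s: "s \<in> S" for c s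
    proof -
      have "root s c \<in> Ch" using root_properties[OF c] by blast
      then have "(root s c, s) \<in> Z n \<Longrightarrow> (g0 (root s c), s) \<in> Z n" using Z_aut[OF g0] by simp
      then show "\<sigma> c s \<in> G s" "\<sigma> c s 1 = 1"
        using a U c s lact_one[OF g0 s c] by (auto simp: \<sigma>_def N_carrier U0_iff simp del: One_nat_def)
    qed
    obtain g where g: "based_aut g" and lact: "\<And>c s. c \<in> Ch \<Longrightarrow> s \<in> S \<Longrightarrow> lact s c g = \<sigma> c s"
      using aut_of_wall_invariant[OF inv local_permutes[OF _ \<sigma>(1)] \<sigma>(2)] by blast
    have gU: "g \<in> carrier U0" using g lact \<sigma>(1) by (simp add: U0_iff)
    have agree: "g c = g0 c" if c: "c \<in> Ch" "depth c \<le> n" for c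
    proof (rule aut_eq_on_ball[OF g g0 _ c])
      fix c s assume c: "c \<in> Ch" "depth c < n" and s: "s \<in> S"
      have "depth (root s c) < n" using root_properties[OF c(1), of s] c(2) by auto
      then have "(root s c, s) \<notin> Z n" by (simp add: Z_set_iff)
      then show "lact s c g = lact s c g0" using lact[OF c(1) s] by (simp add: \<sigma>_def)
    qed
    have "new_actions n g = a"
    proof (rule extensionalityI[of _ "Z n"])
      show "new_actions n g \<in> extensional (Z n)" by (simp add: new_actions_def)
      show "a \<in> extensional (Z n)" using a by (simp add: N_carrier)
      fix z assume "z \<in> Z n"
      then obtain c s where z: "z = (c, s)" "(c, s) \<in> Z n" by (cases z) auto
      let ?x = "iv g0 c"
      have xz: "(?x, s) \<in> Z n" using Z_iv[OF g0 z(2)] .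
      have cCh: "c \<in> Ch" using z by (simp add: Z_set_iff)
      have xp: "?x \<in> Ch" "depth ?x \<le> n" "s \<in> S" "root s ?x = ?x"
        using xz root_fixed by (auto simp: Z_set_iff)
      have g0x: "g0 ?x = c" using iv_simps(2)[OF g0 cCh] .
      have "iv g c = ?x" using iv_eqI[OF g xp(1)] agree[OF xp(1,2)] g0x by simp
      then have "new_actions n g z = \<sigma> ?x s"
        using z new_actions_apply lact[OF xp(1,3)] by simp
      then show "new_actions n g z = a z" using xz xp(4) g0x z by (simp add: \<sigma>_def)
    qed
    moreover have "restrict g (B n) = restrict g0 (B n)"
      using agree by (auto intro!: restrict_ext simp: ball_iff)
    ultimately have "split_ball n g = x" using x by (simp add: split_ball_def)
    then show "x \<in> split_ball n ` carrier U0" using gU by blast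
  qed
qed

text \<open>
  Knowing \<open>g\<close> on the ball of radius \<open>n\<close>, consider its value at a chamber \<open>c\<close> at distance \<open>n + 1\<close>.
  If \<open>c\<close> has two descents, then \<open>g c\<close> lies on two known panels of different types, which meet in at
  most one chamber.  If \<open>s\<close> is its only descent, then \<open>(down s c, s)\<close> is in \<open>Z\<^sub>n\<close>, and the image is
  determined by the recorded local action.
\<close>

lemma split_ball_fibres:
  assumes U: "g \<in> carrier U0" "g' \<in> carrier U0"
  shows "restrict g (B (n + 1)) = restrict g' (B (n + 1)) \<longleftrightarrow> split_ball n g = split_ball n g'"
proof
  have a: "based_aut g" "based_aut g'" using U U0_aut by auto
  {
    assume "restrict g (B (n + 1)) = restrict g' (B (n + 1))"
    then have eq: "g c = g' c" if "c \<in> Ch" "depth c \<le> n + 1" for c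
      using that by (metis restrict_apply' ball_iff)
    have "new_actions n g = new_actions n g'"
      unfolding new_actions_def
    proof (rule restrict_ext, clarify)
      fix c s assume z: "(c, s) \<in> Z n"
      then have c: "c \<in> Ch" "depth c = n" "s \<in> S" by (auto simp: Z_set_iff)
      let ?x = "iv g c"
      have x: "?x \<in> Ch" "depth ?x = n" "g ?x = c"
        using iv_simps[OF a(1) c(1)] iv_depth[OF a(1) c(1)] c by auto
      then have x': "iv g' c = ?x" using iv_eqI[OF a(2) x(1)] eq[OF x(1)] by simp
      have "g (nbr s i ?x) = g' (nbr s i ?x)" if i: "i \<in> {1..q s}" for i
      proof -
        have n: "nbr s i ?x \<in> pan s ?x" using nbr_panel(1)[OF c(3) x(1) i] .
        then show ?thesis
          using eq[OF panel_chamber[OF n]] panel_depth_le[OF c(3) x(1) n] x(2) by simp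
      qed
      then have "lact s ?x g = lact s ?x g'"
        using lact_apply lact_outside by (intro ext) metis
      then show "lact s (iv g c) g = lact s (iv g' c) g'" using x' by simp
    qed
    moreover have "restrict g (B n) = restrict g' (B n)"
      using eq by (auto intro!: restrict_ext simp: ball_iff)
    ultimately show "split_ball n g = split_ball n g'" by (simp add: split_ball_def)
  next
    assume "split_ball n g = split_ball n g'"
    then have act: "new_actions n g = new_actions n g'" and "restrict g (B n) = restrict g' (B n)"
      by (auto simp: split_ball_def)
    then have eq: "g c = g' c" if "c \<in> Ch" "depth c \<le> n" for c
      using that by (metis restrict_apply' ball_iff)
    have "g c = g' c" if c: "c \<in> Ch" "depth c = n + 1" for c
    proof -
      have "c \<noteq> c0" using c depth_eq_0[OF c(1)] by simp
      then obtain s where sd: "s \<in> descents c" using exists_descent c by blast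
      have s: "s \<in> S" using sd descents_gen by blast
      note b = down[OF c(1) sd]
      have down_eq: "g (down t c) = g' (down t c)" if "t \<in> descents c" for t
        using eq down(1,4)[OF c(1) that] c(2) by simp
      show ?thesis
      proof (cases "\<exists>t \<in> descents c. t \<noteq> s")
        case True
        then obtain t where td: "t \<in> descents c" and ts: "t \<noteq> s" by blast
        have t: "t \<in> S" using td descents_gen by blast
        have p: "g' c \<in> pan r (g c)" if r: "r \<in> descents c" for r
        proof -
          have rS: "r \<in> S" using r descents_gen by blast
          note d = down(1,2)[OF c(1) r]
          have "g' c \<in> pan r (g (down r c))"
            using aut_panel[OF a(2) d] down_eq[OF r] by simp
          moreover have "g (down r c) \<in> pan r (g c)"
            using panel_sym[OF aut_chamber[OF a(1) d(1)] rS aut_panel[OF a(1) d]] .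
          ultimately show ?thesis
            using panel_trans[OF aut_chamber[OF a(1) c(1)] rS] by blast
        qed
        show ?thesis
          using panel_Int_panel[OF s t ts[symmetric] aut_chamber[OF a(1) c(1)] p[OF sd] p[OF td]] by simp
      next
        case False
        let ?x = "down s c"
        have "s \<otimes> t \<noteq> t \<otimes> s" if t: "t \<in> descents ?x" for t
        proof
          assume comm: "s \<otimes> t = t \<otimes> s"
          have "t \<noteq> s" using t b(3) by auto
          then have "t \<in> descents c"
            using down_descents_commuting[OF c(1) sd descents_gen[OF t] _ comm] t by simp
          then show False using False \<open>t \<noteq> s\<close> by blast
        qed
        then have z: "(?x, s) \<in> Z n" using b c s by (simp add: Z_set_iff)
        then have z': "(g ?x, s) \<in> Z n" using Z_aut[OF a(1) b(1)] by simp
        have "iv g (g ?x) = ?x" "iv g' (g ?x) = ?x"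
          using iv_simps(3)[OF a(1) b(1)] iv_eqI[OF a(2) b(1)] down_eq[OF sd] by auto
        then have "lact s ?x g = lact s ?x g'"
          using fun_cong[OF act, of "(g ?x, s)"] new_actions_apply[OF z'] by simp
        moreover have "nbr s (h s c) ?x = c" using nbr_eqI[OF s b(1,2)] by simp
        ultimately show ?thesis
          using aut_nbr[OF a(1) s b(1) color_range[OF s c(1)]]
            aut_nbr[OF a(2) s b(1) color_range[OF s c(1)]] down_eq[OF sd] by simp
      qed
    qed
    then show "restrict g (B (n + 1)) = restrict g' (B (n + 1))"
      using eq by (intro restrict_ext) (metis ball_iff le_Suc_eq Suc_eq_plus1)
  }
qed

theorem ball_semidirect: "K (n + 1) \<cong> semidirect_product (N n) (K n) (\<phi> n)"
  by (rule iso_if_same_fibres[OF _ restrict_hom _ split_ball_hom split_ball_surj split_ball_fibres])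
    (auto simp: K_carrier U0_mult U0_closed)

text \<open>
  A compatible family \<open>x\<close> is glued by evaluating at each chamber the first member defined there.
  The result coincides on every ball with an element of the stabilizer, and this suffices for
  membership, since the conditions are local.
\<close>

theorem inverse_limit_balls: "U0 \<cong> inverse_limit K (\<lambda>m n g. restrict g (B m))"
proof -
  let ?L = "inverse_limit K (\<lambda>m n g. restrict g (B m))"
  let ?\<theta> = "\<lambda>g n. restrict g (B n)"
  have L_carrier: "x \<in> carrier ?L \<longleftrightarrow>
      (\<forall>n. x n \<in> carrier (K n)) \<and> (\<forall>m n. m \<le> n \<longrightarrow> restrict (x n) (B m) = x m)" for x
    by (auto simp: inverse_limit_def PiE_iff)
  have L_mult: "x \<otimes>\<^bsub>?L\<^esub> y = (\<lambda>n. x n \<otimes>\<^bsub>K n\<^esub> y n)" for x y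
    by (simp add: inverse_limit_def restrict_def)
  have mono: "B m \<subseteq> B n" if "m \<le> n" for m n using that by (auto simp: ball_iff)
  have \<theta>L: "?\<theta> g \<in> carrier ?L" if "g \<in> carrier U0" for g
    using that mono by (auto simp: L_carrier K_carrier restrict_restrict Int_absorb1)
  have "?\<theta> \<in> hom U0 ?L"
    by (rule homI) (simp_all add: \<theta>L L_mult U0_mult K_mult)
  moreover have "bij_betw ?\<theta> (carrier U0) (carrier ?L)"
  proof (rule bij_betw_imageI)
    show "inj_on ?\<theta> (carrier U0)"
    proof (rule inj_onI)
      fix g g' assume U: "g \<in> carrier U0" "g' \<in> carrier U0" and eq: "?\<theta> g = ?\<theta> g'"
      show "g = g'"
      proof (rule extensionalityI[of _ Ch])
        show "g \<in> extensional Ch" "g' \<in> extensional Ch"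
          using U U0_Bij Bij_imp_extensional by blast+
        fix c assume "c \<in> Ch"
        then show "g c = g' c"
          using fun_cong[OF fun_cong[OF eq, of "depth c"], of c] by (simp add: ball_iff)
      qed
    qed
    show "?\<theta> ` carrier U0 = carrier ?L"
    proof
      show "?\<theta> ` carrier U0 \<subseteq> carrier ?L" using \<theta>L by blast
      show "carrier ?L \<subseteq> ?\<theta> ` carrier U0"
      proof
        fix x assume x: "x \<in> carrier ?L"
        then have "\<forall>n. \<exists>g. g \<in> carrier U0 \<and> x n = restrict g (B n)"
          by (auto simp: L_carrier K_carrier)
        then obtain f where f: "\<And>n. f n \<in> carrier U0" "\<And>n. x n = restrict (f n) (B n)" by metis
        define g where "g = (\<lambda>c \<in> Ch. x (depth c) c)"
        have fa: "based_aut (f n)" for n using f U0_aut by simp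
        have g: "g c = f n c" if c: "c \<in> Ch" "depth c \<le> n" for c n
        proof -
          have "restrict (x n) (B (depth c)) = x (depth c)" using x c by (simp add: L_carrier)
          then have "x (depth c) c = x n c" using c by (metis restrict_apply' ball_iff order.refl)
          then show ?thesis using c f by (simp add: g_def ball_iff)
        qed
        have "based_aut g"
        proof (rule based_aut_if_adjacency_preserved)
          show "g \<in> extensional Ch" by (simp add: g_def)
          show "g c \<in> Ch" if "c \<in> Ch" for c using g[OF that order.refl] aut_chamber[OF fa that] by simp
          show "g c0 = c0" using g[OF base order.refl] fa by (simp add: based_aut_def)
          fix c d s assume cd: "c \<in> Ch" "d \<in> Ch" "s \<in> S" "\<delta> c d = s"
          let ?n = "max (depth c) (depth d)"
          show "\<delta> (g c) (g d) = s"
            using g[OF cd(1), of ?n] g[OF cd(2), of ?n] aut_dist[OF fa cd(1,2)] cd(4) by simp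
        qed
        moreover have "lact s c g \<in> G s" if s: "s \<in> S" and c: "c \<in> Ch" for s c
        proof -
          let ?n = "depth c + 1"
          have "g (nbr s i c) = f ?n (nbr s i c)" if i: "i \<in> {1..q s}" for i
            using g panel_chamber panel_depth_le[OF s c] nbr_panel(1)[OF s c i] by blast
          then have "lact s c g = lact s c (f ?n)"
            using lact_apply lact_outside by (intro ext) metis
          then show ?thesis using f(1) s c by (simp add: U0_iff)
        qed
        ultimately have U: "g \<in> carrier U0" by (simp add: U0_iff)
        have "?\<theta> g = x"
        proof
          fix n
          show "restrict g (B n) = x n"
            unfolding f(2) using g by (intro restrict_ext) (simp add: ball_iff)
        qed
        then show "x \<in> ?\<theta> ` carrier U0" using U by blast
      qed
    qed
  qed
  ultimately show ?thesis by (auto simp: is_iso_def iso_def)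
qed

end

theorem theorem4p7:
  fixes W :: "('w, 'm) monoid_scheme" and S :: "'w set"
    and Ch :: "'c set" and \<delta> :: "'c \<Rightarrow> 'c \<Rightarrow> 'w" and q :: "'w \<Rightarrow> nat" and c0 :: 'c
    and h :: "'w \<Rightarrow> 'c \<Rightarrow> nat" and G :: "'w \<Rightarrow> (nat \<Rightarrow> nat) set"
  assumes "semiregular_right_angled_building W S Ch \<delta> q"
    and "c0 \<in> Ch"
    and "\<And>s. s \<in> S \<Longrightarrow> directed_legal_coloring W S Ch \<delta> q c0 s (h s)"
    and "\<And>s. s \<in> S \<Longrightarrow> transitive_perm_group (q s) (G s)"
  shows "let U0 = chamber_stabilizer Ch (universal_group S Ch \<delta> q h G) c0;
             B = chamber_ball W S Ch \<delta> c0;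
             K = (\<lambda>n. induced_perm_group U0 (B n));
             C = C_set W S Ch \<delta> c0;
             Z = Z_set W S Ch \<delta> c0;
             N = (\<lambda>n. Z_product (Z n) q G);
             \<phi> = (\<lambda>n. permute_entries (B n) (Z n) (N n))
         in (\<forall>n. fst ` Z n = C n \<and>
                 (\<forall>g \<in> carrier (K n). g ` C n = C n) \<and>
                 \<phi> n \<in> hom (K n) (AutoGroup (N n)) \<and>
                 K (n + 1) \<cong> semidirect_product (N n) (K n) (\<phi> n)) \<and>
            U0 \<cong> inverse_limit K (\<lambda>m n g. restrict g (B m))"
proof -
  interpret semiregular_right_angled_building W S Ch \<delta> q by (rule assms(1))
  interpret universal_group_setting W S Ch \<delta> q c0 h G
    by unfold_locales (fact assms(2-4))+
  show ?thesis
    unfolding Let_def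
    using fst_Z_eq_C K_C_image \<phi>_hom ball_semidirect inverse_limit_balls by blast
qed

end
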